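(* Let $m$ be a positive integer and let $(K,\partial_0,\dots,\partial_{m-1})$ be a field with $m$ commuting derivations. Let $n$ and $r$ be positive integers, and suppose $K$ has a field extension $K(a_h^{\xi}\colon|\xi|\le 2r\land h<n)$ that meets the differential condition. Suppose further that for each $k<n$, either $|\sigma|\le r$ whenever $a_k^{\sigma}$ is a minimal separable leader, or else there is some $\tau\in\mathbb{N}^m$ with $|\tau|=2r$ such that $\sigma\le\tau$ whenever $a_k^{\sigma}$ is a minimal separable leader. Then $(K,\partial_0,\dots,\partial_{m-1})$ has an extension $(M,D_0,\dots,D_{m-1})$ (a field $M\supseteq K$ with $m$ commuting derivations extending the $\partial_i$) compatible with $K(a_h^{\xi}\colon|\xi|<2r\land h<n)$, i.e. $K(a_h^{\xi}\colon|\xi|<2r\land h<n)\subseteq M$ and $D_ia_k^{\sigma}=a_k^{\sigma+\varepsilon_i}$ whenever $i<m$, $k<n$ and $|\sigma|+1<2r$.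
   Context: $n$ denotes also $\{0,\dots,n-1\}$. For $\sigma\in\mathbb{N}^m$, $|\sigma|=\sum_{i<m}\sigma(i)$; $\le$ is the componentwise order on $\mathbb{N}^m$; $\varepsilon_i$ is the characteristic function of $\{i\}$ in $\mathbb{N}^m$. The total order $\unlhd$ on $\mathbb{N}^m\times n$: $(\xi,k)\unlhd(\eta,g)$ iff $(|\xi|,k,\xi(0),\dots,\xi(m-2))$ is lexicographically $\le(|\eta|,g,\eta(0),\dots,\eta(m-2))$; $\lhd$ is the strict version. The extension meets the differential condition if: whenever $i<m$, $k<n$, $|\sigma|+1\le 2r$, and $f$ is a polynomial over $K$ in variables $(x_h^{\xi}\colon(\xi,h)\unlhd(\sigma,k))$ vanishing at $a=(a_h^{\xi}\colon(\xi,h)\unlhd(\sigma,k))$, then $\sum_{(\eta,g)\unlhd(\sigma,k)}\frac{\partial f}{\partial x_g^{\eta}}(a)\,a_g^{\eta+\varepsilon_i}+f^{\partial_i}(a)=0$, with $f^{\partial_i}$ being $f$ with $\partial_i$ applied to its coefficients. A generator $a_k^{\sigma}$ is a separable leader if it is separably algebraic over $K(a_h^{\xi}\colon(\xi,h)\lhd(\sigma,k))$, and a minimal separable leader if in addition no $a_k^{\rho}$ with $\rho\le\sigma$, $\rho\ne\sigma$, is a separable leader. *)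

theory Defs
  imports "HOL-Algebra.Ring" "HOL-Computational_Algebra.Polynomial"
begin

definition NN :: "nat \<Rightarrow> (nat \<Rightarrow> nat) set" where
  "NN m = {\<xi>. \<forall>j\<ge>m. \<xi> j = 0}"

definition msize :: "nat \<Rightarrow> (nat \<Rightarrow> nat) \<Rightarrow> nat" where
  "msize m \<xi> = (\<Sum>i<m. \<xi> i)"

definition eps :: "nat \<Rightarrow> nat \<Rightarrow> nat" where
  "eps i = (\<lambda>j. if j = i then 1 else 0)"

definition madd :: "(nat \<Rightarrow> nat) \<Rightarrow> (nat \<Rightarrow> nat) \<Rightarrow> nat \<Rightarrow> nat" where
  "madd \<xi> \<eta> = (\<lambda>j. \<xi> j + \<eta> j)"

definition mle :: "nat \<Rightarrow> (nat \<Rightarrow> nat) \<Rightarrow> (nat \<Rightarrow> nat) \<Rightarrow> bool" where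
  "mle m \<rho> \<sigma> = (\<forall>i<m. \<rho> i \<le> \<sigma> i)"

definition lexle :: "nat \<Rightarrow> (nat \<Rightarrow> nat) \<Rightarrow> (nat \<Rightarrow> nat) \<Rightarrow> bool" where
  "lexle l \<xi> \<eta> = ((\<forall>j<l. \<xi> j = \<eta> j) \<or>
     (\<exists>j<l. (\<forall>i<j. \<xi> i = \<eta> i) \<and> \<xi> j < \<eta> j))"

definition tle :: "nat \<Rightarrow> (nat \<Rightarrow> nat) \<times> nat \<Rightarrow> (nat \<Rightarrow> nat) \<times> nat \<Rightarrow> bool" where
  "tle m p q = (case p of (\<xi>, k) \<Rightarrow> case q of (\<eta>, g) \<Rightarrow>
      msize m \<xi> < msize m \<eta> \<or>
      (msize m \<xi> = msize m \<eta> \<and> (k < g \<or> (k = g \<and> lexle (m - 1) \<xi> \<eta>))))"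

definition tlt :: "nat \<Rightarrow> (nat \<Rightarrow> nat) \<times> nat \<Rightarrow> (nat \<Rightarrow> nat) \<times> nat \<Rightarrow> bool" where
  "tlt m p q = (tle m p q \<and> p \<noteq> q)"

text \<open>Index set of the variables x_h^xi with (xi,h) \<unlhd> (sigma,k) (only h < n exist).\<close>
definition varsle :: "nat \<Rightarrow> nat \<Rightarrow> (nat \<Rightarrow> nat) \<Rightarrow> nat \<Rightarrow> ((nat \<Rightarrow> nat) \<times> nat) set" where
  "varsle m n \<sigma> k = {(\<xi>, h). \<xi> \<in> NN m \<and> h < n \<and> tle m (\<xi>, h) (\<sigma>, k)}"

definition varslt :: "nat \<Rightarrow> nat \<Rightarrow> (nat \<Rightarrow> nat) \<Rightarrow> nat \<Rightarrow> ((nat \<Rightarrow> nat) \<times> nat) set" where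
  "varslt m n \<sigma> k = {(\<xi>, h). \<xi> \<in> NN m \<and> h < n \<and> tlt m (\<xi>, h) (\<sigma>, k)}"

definition is_subfield_set :: "'a::field set \<Rightarrow> bool" where
  "is_subfield_set F = (0 \<in> F \<and> 1 \<in> F \<and>
     (\<forall>x\<in>F. \<forall>y\<in>F. x + y \<in> F \<and> x - y \<in> F \<and> x * y \<in> F) \<and>
     (\<forall>x\<in>F. inverse x \<in> F))"

definition gen_field :: "'a::field set \<Rightarrow> 'a set" where
  "gen_field S = \<Inter>{F. is_subfield_set F \<and> S \<subseteq> F}"

definition derivation_on :: "'a::field set \<Rightarrow> ('a \<Rightarrow> 'a) \<Rightarrow> bool" where
  "derivation_on K d = ((\<forall>x\<in>K. d x \<in> K) \<and>
     (\<forall>x\<in>K. \<forall>y\<in>K. d (x + y) = d x + d y \<and> d (x * y) = x * d y + d x * y))"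

definition diff_field :: "'a::field set \<Rightarrow> nat \<Rightarrow> (nat \<Rightarrow> 'a \<Rightarrow> 'a) \<Rightarrow> bool" where
  "diff_field K m d = (is_subfield_set K \<and> (\<forall>i<m. derivation_on K (d i)) \<and>
     (\<forall>i<m. \<forall>j<m. \<forall>x\<in>K. d i (d j x) = d j (d i x)))"

text \<open>A polynomial is a finitely supported map from monomials (exponent
  functions on the variables) to coefficients.\<close>
definition psupp :: "(('v \<Rightarrow> nat) \<Rightarrow> 'a::field) \<Rightarrow> ('v \<Rightarrow> nat) set" where
  "psupp f = {e. f e \<noteq> 0}"

definition is_poly_over :: "'a::field set \<Rightarrow> 'v set \<Rightarrow> (('v \<Rightarrow> nat) \<Rightarrow> 'a) \<Rightarrow> bool" where
  "is_poly_over K V f = (finite (psupp f) \<and> (\<forall>e. f e \<in> K) \<and>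
     (\<forall>e\<in>psupp f. finite {v. e v \<noteq> 0} \<and> {v. e v \<noteq> 0} \<subseteq> V))"

definition peval :: "(('v \<Rightarrow> nat) \<Rightarrow> 'a::field) \<Rightarrow> ('v \<Rightarrow> 'a) \<Rightarrow> 'a" where
  "peval f a = (\<Sum>e\<in>psupp f. f e * (\<Prod>v\<in>{v. e v \<noteq> 0}. a v ^ e v))"

definition ppartial_eval :: "(('v \<Rightarrow> nat) \<Rightarrow> 'a::field) \<Rightarrow> 'v \<Rightarrow> ('v \<Rightarrow> 'a) \<Rightarrow> 'a" where
  "ppartial_eval f w a = (\<Sum>e\<in>psupp f. f e * of_nat (e w) * a w ^ (e w - 1) *
       (\<Prod>v\<in>{v. e v \<noteq> 0} - {w}. a v ^ e v))"

definition pcoeffmap :: "('a \<Rightarrow> 'a) \<Rightarrow> (('v \<Rightarrow> nat) \<Rightarrow> 'a::field) \<Rightarrow> ('v \<Rightarrow> nat) \<Rightarrow> 'a" where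
  "pcoeffmap d f = (\<lambda>e. d (f e))"

text \<open>a h xi is the generator a_h^xi; it is used for xi \<in> N^m, |xi| \<le> 2r, h < n.\<close>
definition differential_condition ::
  "'a::field set \<Rightarrow> nat \<Rightarrow> (nat \<Rightarrow> 'a \<Rightarrow> 'a) \<Rightarrow> nat \<Rightarrow> nat \<Rightarrow> (nat \<Rightarrow> (nat \<Rightarrow> nat) \<Rightarrow> 'a) \<Rightarrow> bool" where
  "differential_condition K m d n r a =
    (\<forall>i<m. \<forall>k<n. \<forall>\<sigma>\<in>NN m. msize m \<sigma> + 1 \<le> 2 * r \<longrightarrow>
      (\<forall>f. is_poly_over K (varsle m n \<sigma> k) f \<longrightarrow>
         peval f (\<lambda>(\<xi>, h). a h \<xi>) = 0 \<longrightarrow>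
         (\<Sum>(\<eta>, g)\<in>varsle m n \<sigma> k.
             ppartial_eval f (\<eta>, g) (\<lambda>(\<xi>, h). a h \<xi>) * a g (madd \<eta> (eps i)))
         + peval (pcoeffmap (d i) f) (\<lambda>(\<xi>, h). a h \<xi>) = 0))"

definition poly_over :: "'a::field set \<Rightarrow> 'a poly \<Rightarrow> bool" where
  "poly_over F p = (\<forall>i. coeff p i \<in> F)"

text \<open>x is separably algebraic over the subfield F: x is a root of a separable
  polynomial over F, i.e. one coprime (over F) to its formal derivative.\<close>
definition sep_algebraic :: "'a::field set \<Rightarrow> 'a \<Rightarrow> bool" where
  "sep_algebraic F x = (\<exists>p. poly_over F p \<and> poly p x = 0 \<and>
     (\<exists>u v. poly_over F u \<and> poly_over F v \<and> u * p + v * pderiv p = 1))"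

definition sep_leader ::
  "'a::field set \<Rightarrow> nat \<Rightarrow> nat \<Rightarrow> nat \<Rightarrow> (nat \<Rightarrow> (nat \<Rightarrow> nat) \<Rightarrow> 'a) \<Rightarrow> nat \<Rightarrow> (nat \<Rightarrow> nat) \<Rightarrow> bool" where
  "sep_leader K m n r a k \<sigma> = (k < n \<and> \<sigma> \<in> NN m \<and> msize m \<sigma> \<le> 2 * r \<and>
     sep_algebraic (gen_field (K \<union> {a h \<xi> | \<xi> h. (\<xi>, h) \<in> varslt m n \<sigma> k})) (a k \<sigma>))"

definition min_sep_leader ::
  "'a::field set \<Rightarrow> nat \<Rightarrow> nat \<Rightarrow> nat \<Rightarrow> (nat \<Rightarrow> (nat \<Rightarrow> nat) \<Rightarrow> 'a) \<Rightarrow> nat \<Rightarrow> (nat \<Rightarrow> nat) \<Rightarrow> bool" where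
  "min_sep_leader K m n r a k \<sigma> = (sep_leader K m n r a k \<sigma> \<and>
     (\<forall>\<rho>\<in>NN m. mle m \<rho> \<sigma> \<and> \<rho> \<noteq> \<sigma> \<longrightarrow> \<not> sep_leader K m n r a k \<rho>))"

definition ring_derivation :: "('b, 'c) ring_scheme \<Rightarrow> ('b \<Rightarrow> 'b) \<Rightarrow> bool" where
  "ring_derivation M D = ((\<forall>x\<in>carrier M. D x \<in> carrier M) \<and>
     (\<forall>x\<in>carrier M. \<forall>y\<in>carrier M. D (x \<oplus>\<^bsub>M\<^esub> y) = D x \<oplus>\<^bsub>M\<^esub> D y \<and>
        D (x \<otimes>\<^bsub>M\<^esub> y) = (x \<otimes>\<^bsub>M\<^esub> D y) \<oplus>\<^bsub>M\<^esub> (D x \<otimes>\<^bsub>M\<^esub> y)))"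

end

theory Submission
  imports Defs "HOL-Library.Poly_Mapping" "HOL-Computational_Algebra.Fraction_Field" "HOL-Library.Countable"
begin

text \<open>Write \<open>L\<close> for \<open>K(a\<^sub>k\<^sup>\<sigma> : |\<sigma>| < 2r)\<close>. The differential condition says exactly that \<open>\<partial>\<^sub>i\<close> extends
  to a derivation \<open>\<delta>\<^sub>i\<close> on \<open>L\<close> with \<open>\<delta>\<^sub>i a\<^sub>k\<^sup>\<sigma> = a\<^sub>k\<^sup>\<sigma>\<^sup>+\<^sup>\<epsilon>\<^sup>i\<close>, whose values lie in the \<open>L\<close>-linear span
  of \<open>1\<close> and the generators of order \<open>2r\<close>. The field \<open>M\<close> is the purely transcendental extension of \<open>L\<close>
  with one indeterminate for every index of order at least \<open>2r\<close> that is not above a leader.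
  The values \<open>A\<^sub>v\<close> at the remaining indices of order greater than \<open>2r\<close> are defined by recursion along
  the order: \<open>A\<^sub>v = D\<^sub>i A\<^sub>w\<close> for some leader \<open>w\<close> with \<open>w + \<epsilon>\<^sub>i = v\<close>. This does not depend on \<open>w\<close> and \<open>i\<close>:
  the hypothesis bounds the join of two minimal leaders by order \<open>2r\<close>, so any two choices
  are connected through a third such that neighbouring choices have a common leader \<open>\<pi>\<close> two steps
  below \<open>v\<close>, and there the commutator \<open>[D\<^sub>i, D\<^sub>l]\<close> is a derivation that vanishes below \<open>\<pi>\<close>, hence,
  by separability, at \<open>\<pi>\<close>. So \<open>D\<^sub>i A\<^sub>v = A\<^sub>v\<^sub>+\<^sub>\<epsilon>\<^sub>i\<close> always holds, and the \<open>D\<^sub>i\<close> commute.\<close>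

section \<open>Subfields and derivations\<close>

lemma subfield_setD:
  assumes "is_subfield_set F"
  shows "0 \<in> F" "1 \<in> F" "\<And>x y. x \<in> F \<Longrightarrow> y \<in> F \<Longrightarrow> x + y \<in> F"
    "\<And>x y. x \<in> F \<Longrightarrow> y \<in> F \<Longrightarrow> x - y \<in> F"
    "\<And>x y. x \<in> F \<Longrightarrow> y \<in> F \<Longrightarrow> x * y \<in> F" "\<And>x. x \<in> F \<Longrightarrow> inverse x \<in> F"
    "\<And>x. x \<in> F \<Longrightarrow> - x \<in> F"
proof -
  show "0 \<in> F" "1 \<in> F" and mi: "\<And>x y. x \<in> F \<Longrightarrow> y \<in> F \<Longrightarrow> x - y \<in> F"
    using assms by (auto simp: is_subfield_set_def)
  show "\<And>x y. x \<in> F \<Longrightarrow> y \<in> F \<Longrightarrow> x + y \<in> F"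
    "\<And>x y. x \<in> F \<Longrightarrow> y \<in> F \<Longrightarrow> x * y \<in> F" "\<And>x. x \<in> F \<Longrightarrow> inverse x \<in> F"
    using assms by (auto simp: is_subfield_set_def)
  show "- x \<in> F" if "x \<in> F" for x
    using mi[of 0 x] that \<open>0 \<in> F\<close> by simp
qed

lemma subfield_set_power: "is_subfield_set F \<Longrightarrow> x \<in> F \<Longrightarrow> x ^ j \<in> F"
  by (induction j) (auto simp: subfield_setD)

lemma subfield_set_sum:
  "is_subfield_set F \<Longrightarrow> (\<And>i. i \<in> I \<Longrightarrow> f i \<in> F) \<Longrightarrow> sum f I \<in> F"
  by (induction I rule: infinite_finite_induct) (auto simp: subfield_setD)

lemma is_subfield_set_gen_field: "is_subfield_set (gen_field S)"
  unfolding gen_field_def is_subfield_set_def by auto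

lemmas gen_fieldI = subfield_setD[OF is_subfield_set_gen_field]

lemma gen_field_superset: "S \<subseteq> gen_field S"
  unfolding gen_field_def by auto

lemma gen_field_base: "x \<in> S \<Longrightarrow> x \<in> gen_field S"
  using gen_field_superset by auto

lemma gen_field_least: "is_subfield_set F \<Longrightarrow> S \<subseteq> F \<Longrightarrow> gen_field S \<subseteq> F"
  unfolding gen_field_def by auto

lemma gen_field_mono: "S \<subseteq> T \<Longrightarrow> gen_field S \<subseteq> gen_field T"
  unfolding gen_field_def by auto

section \<open>Field homomorphisms, and derivations along them\<close>

locale field_hom =
  fixes e :: "'a::field \<Rightarrow> 'b::field"
  assumes hom_add: "e (x + y) = e x + e y"
    and hom_mult: "e (x * y) = e x * e y"
    and hom_one: "e 1 = 1"
begin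

lemma hom_zero: "e 0 = 0"
  using hom_add[of 0 0] by (metis add_0 add_cancel_right_right)

lemma hom_minus: "e (- x) = - e x"
  using hom_add[of x "-x"] hom_zero by (simp add: eq_neg_iff_add_eq_0 add.commute)

lemma hom_diff: "e (x - y) = e x - e y"
  using hom_add[of x "-y"] by (simp add: hom_minus)

lemma hom_eq_0: "e x = 0 \<longleftrightarrow> x = 0"
proof
  assume "e x = 0"
  show "x = 0"
  proof (rule ccontr)
    assume "x \<noteq> 0"
    then show False using hom_mult[of x "inverse x"] \<open>e x = 0\<close> hom_one by simp
  qed
qed (simp add: hom_zero)

lemma hom_inj: "inj e"
  by (rule injI) (metis hom_diff hom_eq_0 right_minus_eq)

lemma hom_inverse: "e (inverse x) = inverse (e x)"
proof (cases "x = 0")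
  case False
  then show ?thesis using hom_mult[of x "inverse x"] hom_one
    by (simp add: inverse_unique)
qed (simp add: hom_zero)

lemma hom_power: "e (x ^ j) = e x ^ j"
  by (induction j) (auto simp: hom_one hom_mult)

lemma hom_sum: "e (sum f I) = (\<Sum>i\<in>I. e (f i))"
  by (induction I rule: infinite_finite_induct) (auto simp: hom_zero hom_add)

lemma subfield_set_image:
  assumes "is_subfield_set F"
  shows "is_subfield_set (e ` F)"
  unfolding is_subfield_set_def
proof (intro conjI ballI)
  note F = subfield_setD[OF assms]
  show "0 \<in> e ` F" "1 \<in> e ` F"
    using F(1,2) hom_zero hom_one by (metis image_eqI)+
  fix x assume "x \<in> e ` F"
  then obtain x' where x: "x = e x'" "x' \<in> F" by auto
  then show "inverse x \<in> e ` F"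
    using F(6) by (simp flip: hom_inverse)
  fix y assume "y \<in> e ` F"
  then obtain y' where y: "y = e y'" "y' \<in> F" by auto
  show "x + y \<in> e ` F" "x - y \<in> e ` F" "x * y \<in> e ` F"
    using F x y by (simp_all flip: hom_add hom_diff hom_mult)
qed

end

lemma field_hom_id: "field_hom id"
  by unfold_locales auto

text \<open>Values lie in a second field on which the first acts through \<open>e\<close>. The case
  \<open>e = id\<close> gives ordinary derivations; the general case serves for commutators
  restricted to the image of \<open>L\<close>. Values in \<open>F\<close> are not demanded, since
  \<open>\<delta> i\<close> leads out of \<open>L\<close>.\<close>

definition der_on :: "('a::field \<Rightarrow> 'b::field) \<Rightarrow> 'a set \<Rightarrow> ('a \<Rightarrow> 'b) \<Rightarrow> bool" where
  "der_on e F D \<longleftrightarrow> (\<forall>x\<in>F. \<forall>y\<in>F. D (x + y) = D x + D y \<and> D (x * y) = e x * D y + D x * e y)"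

lemma der_on_mono: "der_on e F D \<Longrightarrow> E \<subseteq> F \<Longrightarrow> der_on e E D"
  unfolding der_on_def by blast

context field_hom
begin

context
  fixes F D
  assumes F: "is_subfield_set F" and D: "der_on e F D"
begin

lemma der_add: "x \<in> F \<Longrightarrow> y \<in> F \<Longrightarrow> D (x + y) = D x + D y"
  and der_mult: "x \<in> F \<Longrightarrow> y \<in> F \<Longrightarrow> D (x * y) = e x * D y + D x * e y"
  using D by (auto simp: der_on_def)

lemma der_zero: "D 0 = 0"
  using der_add[of 0 0] subfield_setD(1)[OF F] by (metis add_0 add_cancel_right_right)

lemma der_one: "D 1 = 0"
  using der_mult[of 1 1] subfield_setD(2)[OF F]
  by (metis add_cancel_right_right hom_one mult_1 mult.right_neutral)

lemma der_minus: "x \<in> F \<Longrightarrow> D (- x) = - D x"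
  using der_add[of x "-x"] subfield_setD(7)[OF F] der_zero
  by (simp add: eq_neg_iff_add_eq_0 add.commute)

lemma der_diff: "x \<in> F \<Longrightarrow> y \<in> F \<Longrightarrow> D (x - y) = D x - D y"
  using der_add[of x "-y"] der_minus[of y] subfield_setD(7)[OF F] by simp

lemma der_inverse:
  assumes x: "x \<in> F" shows "D (inverse x) = - e (inverse x * inverse x) * D x"
proof (cases "x = 0")
  case False
  then have ex: "e x \<noteq> 0" by (simp add: hom_eq_0)
  have "0 = e x * D (inverse x) + D x * e (inverse x)"
    using der_mult[of x "inverse x"] x subfield_setD(6)[OF F] False der_one by simp
  then have "e x * D (inverse x) = - D x * inverse (e x)"
    by (simp add: hom_inverse eq_neg_iff_add_eq_0)
  then have "D (inverse x) = - D x * inverse (e x) / e x"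
    using ex by (metis nonzero_mult_div_cancel_left)
  also have "\<dots> = - e (inverse x * inverse x) * D x"
    by (simp add: hom_mult hom_inverse divide_inverse mult_ac)
  finally show ?thesis .
qed (simp add: der_zero)

lemma der_sum: "(\<And>i. i \<in> I \<Longrightarrow> f i \<in> F) \<Longrightarrow> D (sum f I) = (\<Sum>i\<in>I. D (f i))"
  by (induction I rule: infinite_finite_induct)
    (auto simp: der_zero der_add subfield_set_sum[OF F])

lemma der_power: "x \<in> F \<Longrightarrow> D (x ^ j) = of_nat j * e (x ^ (j - 1)) * D x"
proof (induction j)
  case 0 then show ?case by (simp add: der_one)
next
  case (Suc j)
  then show ?case
    using subfield_set_power[OF F, of x j]
    by (cases j) (simp_all add: der_mult hom_mult hom_power hom_one algebra_simps)
qed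

text \<open>Differentiate \<open>p x = 0\<close>; the Bezout identity makes \<open>p' x\<close> invertible.\<close>

lemma der_sep_algebraic:
  assumes sub: "is_subfield_set E" "E \<subseteq> F" and x: "x \<in> F" "sep_algebraic E x"
    and W: "\<And>u v. u \<in> W \<Longrightarrow> v \<in> W \<Longrightarrow> u + v \<in> W" "0 \<in> W"
    "\<And>c u. c \<in> F \<Longrightarrow> u \<in> W \<Longrightarrow> e c * u \<in> W"
    and DE: "\<And>y. y \<in> E \<Longrightarrow> D y \<in> W"
  shows "D x \<in> W"
proof -
  obtain p u v where p: "poly_over E p" "poly p x = 0" "poly_over E u" "poly_over E v"
    and bez: "u * p + v * pderiv p = 1"
    using x(2) unfolding sep_algebraic_def by auto
  let ?q = "poly (pderiv p) x"
  have "poly (u * p + v * pderiv p) x = 1"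
    using bez by simp
  then have q0: "?q \<noteq> 0"
    using p(2) by auto
  have Wsum: "sum f I \<in> W" if "\<And>i. i \<in> I \<Longrightarrow> f i \<in> W" for f and I :: "nat set"
    using that by (induction I rule: infinite_finite_induct) (auto simp: W)
  have cf: "coeff p i \<in> F" for i
    using p(1) sub(2) by (auto simp: poly_over_def)
  \<comment> \<open>This is \<open>p\<close> with \<open>D\<close> applied to its coefficients,
    evaluated at \<open>x\<close>; the product rule splits \<open>D (poly p x)\<close> into
    \<open>s\<close> and a multiple of \<open>D x\<close>.\<close>
  define s where "s = (\<Sum>i\<le>degree p. e (x ^ i) * D (coeff p i))"
  have sW: "s \<in> W"
    unfolding s_def using p(1) DE x(1)
    by (intro Wsum W(3)) (auto simp: poly_over_def intro: subfield_set_power[OF F])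
  have dp: "poly (pderiv p) x = (\<Sum>i\<le>degree p. of_nat i * coeff p i * x ^ (i - 1))"
  proof (cases "degree p")
    case 0
    then obtain c where "p = [:c:]" by (rule degree_eq_zeroE)
    then show ?thesis by (simp add: pderiv_pCons)
  next
    case (Suc j)
    have "poly (pderiv p) x = (\<Sum>i\<le>j. coeff (pderiv p) i * x ^ i)"
    proof -
      have dj: "degree (pderiv p) \<le> j"
        by (rule degree_le) (auto simp: coeff_pderiv Suc coeff_eq_0)
      show ?thesis
        unfolding poly_altdef using dj
        by (intro sum.mono_neutral_left) (auto simp: coeff_eq_0)
    qed
    also have "\<dots> = (\<Sum>i\<le>degree p. of_nat i * coeff p i * x ^ (i - 1))"
      unfolding Suc by (subst sum.atMost_Suc_shift) (simp add: coeff_pderiv)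
    finally show ?thesis .
  qed
  have qF: "?q \<in> F"
  proof -
    have nat: "of_nat i \<in> F" for i :: nat
      by (induction i) (auto simp: subfield_setD[OF F])
    show ?thesis
      unfolding dp using cf x(1) nat
      by (intro subfield_set_sum[OF F]) (auto intro!: subfield_setD(5)[OF F] subfield_set_power[OF F])
  qed
  have "0 = D (poly p x)"
    using p(2) der_zero by simp
  also have "\<dots> = (\<Sum>i\<le>degree p. D (coeff p i * x ^ i))"
    unfolding poly_altdef using cf x(1)
    by (intro der_sum) (auto intro: subfield_setD(5)[OF F] subfield_set_power[OF F])
  also have "\<dots> = (\<Sum>i\<le>degree p. e (x ^ i) * D (coeff p i) + e (of_nat i * coeff p i * x ^ (i - 1)) * D x)"
  proof (rule sum.cong[OF refl])
    fix i
    have ofn: "e (of_nat i) = of_nat i"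
      by (induction i) (auto simp: hom_zero hom_one hom_add)
    show "D (coeff p i * x ^ i) = e (x ^ i) * D (coeff p i) + e (of_nat i * coeff p i * x ^ (i - 1)) * D x"
      using cf x(1) by (simp add: der_mult der_power subfield_set_power[OF F] hom_mult ofn mult_ac)
  qed
  also have "\<dots> = s + e ?q * D x"
    unfolding s_def dp hom_sum sum_distrib_right by (simp add: sum.distrib)
  finally have "e ?q * D x = - s"
    by (simp add: eq_neg_iff_add_eq_0 add.commute)
  then have "D x = e (- inverse ?q) * s"
    using q0 hom_eq_0[of ?q] unfolding hom_minus hom_inverse
    by (simp add: divide_simps) (simp add: mult.commute)
  then show ?thesis
    using W(3)[OF _ sW, of "- inverse ?q"] qF subfield_setD[OF F] by simp
qed

end

text \<open>By the sum, product and quotient rules, the elements whose derivative lies in the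
  submodule \<open>W\<close> form a subfield, so checking the generators is enough. With
  \<open>W = {0}\<close> this yields uniqueness and vanishing of derivations, with \<open>W\<close>
  a field or a span it bounds where the values lie.\<close>

lemma der_gen_field:
  assumes D: "der_on e (gen_field S) D"
    and W: "\<And>u v. u \<in> W \<Longrightarrow> v \<in> W \<Longrightarrow> u + v \<in> W" "0 \<in> W"
    "\<And>c u. c \<in> gen_field S \<Longrightarrow> u \<in> W \<Longrightarrow> e c * u \<in> W"
    and DS: "\<And>y. y \<in> S \<Longrightarrow> D y \<in> W"
    and x: "x \<in> gen_field S"
  shows "D x \<in> W"
proof -
  note sf = is_subfield_set_gen_field[of S]
  note der = der_zero[OF sf D] der_one[OF sf D] der_add[OF sf D] der_diff[OF sf D]
    der_mult[OF sf D] der_inverse[OF sf D]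
  have neg: "- u \<in> W" if "u \<in> W" for u
    using W(3)[of "-1" u] that by (simp add: gen_fieldI hom_minus hom_one)
  have "is_subfield_set {x \<in> gen_field S. D x \<in> W}"
    unfolding is_subfield_set_def
  proof (intro conjI ballI)
    fix x y assume xy: "x \<in> {x \<in> gen_field S. D x \<in> W}" "y \<in> {x \<in> gen_field S. D x \<in> W}"
    show "x - y \<in> {x \<in> gen_field S. D x \<in> W}"
      using xy neg[of "D y"] W(1)[of "D x" "- D y"] by (auto simp: der gen_fieldI)
    show "x * y \<in> {x \<in> gen_field S. D x \<in> W}"
      using xy W(3)[of x "D y"] W(3)[of y "D x"] W(1)
      by (auto simp: der gen_fieldI mult.commute)
    show "inverse x \<in> {x \<in> gen_field S. D x \<in> W}"
      using xy neg W(3)[of "inverse x * inverse x" "D x"] by (auto simp: der gen_fieldI)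
  qed (auto simp: der gen_fieldI W)
  moreover have "S \<subseteq> {x \<in> gen_field S. D x \<in> W}"
    using DS gen_field_base by auto
  ultimately have "gen_field S \<subseteq> {x \<in> gen_field S. D x \<in> W}"
    by (rule gen_field_least)
  then show ?thesis using x by auto
qed

lemma der_gen_field_eq:
  assumes "der_on e (gen_field S) D" "der_on e (gen_field S) D'"
    and "\<And>y. y \<in> S \<Longrightarrow> D y = D' y" and "x \<in> gen_field S"
  shows "D x = D' x"
proof -
  have "der_on e (gen_field S) (\<lambda>x. D x - D' x)"
    using assms(1,2) by (auto simp: der_on_def algebra_simps)
  from der_gen_field[OF this, of "{0}"] have "D x - D' x \<in> {0}"
    using assms(3,4) by auto
  then show ?thesis by simp
qed

end

section \<open>Extending derivations to generated fields\<close>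

definition mval :: "('v \<Rightarrow> 'a::field) \<Rightarrow> ('v \<Rightarrow> nat) \<Rightarrow> 'a" where
  "mval A p = (\<Prod>v\<in>{v. p v \<noteq> 0}. A v ^ p v)"

text \<open>The derivative of the monomial that the product rule forces once \<open>A v\<close> has
  derivative \<open>B v\<close>. The exponents \<open>p v - 1\<close> are never truncated, because
  the sum runs over the support.\<close>

definition dmval :: "('v \<Rightarrow> 'a::field) \<Rightarrow> ('v \<Rightarrow> 'a) \<Rightarrow> ('v \<Rightarrow> nat) \<Rightarrow> 'a" where
  "dmval A B p = (\<Sum>v\<in>{v. p v \<noteq> 0}.
     of_nat (p v) * A v ^ (p v - 1) * (\<Prod>w\<in>{w. p w \<noteq> 0} - {v}. A w ^ p w) * B v)"

text \<open>The only possible derivative of \<open>peval f A\<close> when coefficients are derived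
  by \<open>d\<close> and \<open>A v\<close> is sent to \<open>B v\<close>. A derivation with these
  data can exist only if this vanishes whenever \<open>peval f A\<close> does.\<close>

definition pder :: "('a \<Rightarrow> 'a::field) \<Rightarrow> (('v \<Rightarrow> nat) \<Rightarrow> 'a) \<Rightarrow> ('v \<Rightarrow> 'a) \<Rightarrow> ('v \<Rightarrow> 'a) \<Rightarrow> 'a" where
  "pder d f A B = (\<Sum>p\<in>psupp f. d (f p) * mval A p + f p * dmval A B p)"

lemma mval_superset:
  assumes "finite U" "{v. p v \<noteq> 0} \<subseteq> U"
  shows "mval A p = (\<Prod>v\<in>U. A v ^ p v)"
  unfolding mval_def using assms by (intro prod.mono_neutral_left) auto

text \<open>Indices outside the support contribute coefficient 0 or a factor with exponent 0. This
  permits one common index set for two exponents with different supports.\<close>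

lemma dmval_superset:
  assumes U: "finite U" "{v. p v \<noteq> 0} \<subseteq> U"
  shows "dmval A B p = (\<Sum>v\<in>U. of_nat (p v) * A v ^ (p v - 1) * (\<Prod>w\<in>U - {v}. A w ^ p w) * B v)"
proof -
  have "dmval A B p = (\<Sum>v\<in>{v. p v \<noteq> 0}. of_nat (p v) * A v ^ (p v - 1) * (\<Prod>w\<in>U - {v}. A w ^ p w) * B v)"
    unfolding dmval_def
  proof (rule sum.cong[OF refl])
    fix v
    have "(\<Prod>w\<in>{w. p w \<noteq> 0} - {v}. A w ^ p w) = (\<Prod>w\<in>U - {v}. A w ^ p w)"
    proof (rule prod.mono_neutral_left)
      show "\<forall>i\<in>U - {v} - ({w. p w \<noteq> 0} - {v}). A i ^ p i = 1"
      proof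
        fix i assume "i \<in> U - {v} - ({w. p w \<noteq> 0} - {v})"
        then have "p i = 0" by auto
        then show "A i ^ p i = 1" by simp
      qed
    qed (use U in auto)
    then show "of_nat (p v) * A v ^ (p v - 1) * (\<Prod>w\<in>{w. p w \<noteq> 0} - {v}. A w ^ p w) * B v
      = of_nat (p v) * A v ^ (p v - 1) * (\<Prod>w\<in>U - {v}. A w ^ p w) * B v" by simp
  qed
  also have "\<dots> = (\<Sum>v\<in>U. of_nat (p v) * A v ^ (p v - 1) * (\<Prod>w\<in>U - {v}. A w ^ p w) * B v)"
    using U by (intro sum.mono_neutral_left) auto
  finally show ?thesis .
qed

lemma mval_0 [simp]: "mval A (\<lambda>_. 0) = 1" and dmval_0 [simp]: "dmval A B (\<lambda>_. 0) = 0"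
  by (simp_all add: mval_def dmval_def)

lemma mval_single: "mval A (\<lambda>w. if w = v then 1 else 0) = A v"
  and dmval_single: "dmval A B (\<lambda>w. if w = v then 1 else 0) = B v"
  by (subst mval_superset[of "{v}"] dmval_superset[of "{v}"]; auto)+

lemma mval_add:
  assumes "finite {v. p v \<noteq> 0}" "finite {v. q v \<noteq> 0}"
  shows "mval A (\<lambda>v. p v + q v) = mval A p * mval A q"
proof -
  let ?U = "{v. p v \<noteq> 0} \<union> {v. q v \<noteq> 0}"
  have U: "finite ?U" using assms by auto
  show ?thesis
    using U by (simp add: mval_superset[of ?U] power_add prod.distrib subset_iff)
qed

lemma dmval_add:
  assumes "finite {v. p v \<noteq> 0}" "finite {v. q v \<noteq> 0}"
  shows "dmval A B (\<lambda>v. p v + q v) = mval A p * dmval A B q + dmval A B p * mval A q"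
proof -
  let ?U = "{v. p v \<noteq> 0} \<union> {v. q v \<noteq> 0}"
  let ?P = "\<lambda>p v. \<Prod>w\<in>?U - {v}. A w ^ p w"
  have U: "finite ?U" using assms by auto
  have m: "mval A s = A v ^ s v * ?P s v" if "v \<in> ?U" "{v. s v \<noteq> 0} \<subseteq> ?U" for s v
    using that U by (simp add: mval_superset[of ?U] prod.remove)
  have "dmval A B (\<lambda>v. p v + q v) =
    (\<Sum>v\<in>?U. of_nat (p v + q v) * A v ^ (p v + q v - 1) * (?P p v * ?P q v) * B v)"
    using U by (subst dmval_superset[of ?U]) (auto simp: power_add prod.distrib)
  also have "\<dots> = (\<Sum>v\<in>?U. mval A p * (of_nat (q v) * A v ^ (q v - 1) * ?P q v * B v)
      + (of_nat (p v) * A v ^ (p v - 1) * ?P p v * B v) * mval A q)"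
  proof (rule sum.cong[OF refl])
    fix v assume v: "v \<in> ?U"
    have mp: "mval A p = A v ^ p v * ?P p v" and mq: "mval A q = A v ^ q v * ?P q v"
      using m v by auto
    \<comment> \<open>The product rule for powers; wherever subtraction is truncated, the
      coefficient is 0.\<close>
    have "of_nat (p v + q v) * A v ^ (p v + q v - 1) =
      A v ^ p v * (of_nat (q v) * A v ^ (q v - 1)) + of_nat (p v) * A v ^ (p v - 1) * A v ^ q v"
      by (cases "p v"; cases "q v") (simp_all add: power_add algebra_simps)
    then show "of_nat (p v + q v) * A v ^ (p v + q v - 1) * (?P p v * ?P q v) * B v =
       mval A p * (of_nat (q v) * A v ^ (q v - 1) * ?P q v * B v)
      + (of_nat (p v) * A v ^ (p v - 1) * ?P p v * B v) * mval A q"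
      unfolding mp mq by (simp only: algebra_simps)
  qed
  also have "\<dots> = mval A p * dmval A B q + dmval A B p * mval A q"
    using U by (simp add: sum.distrib dmval_superset[of ?U] subset_iff sum_distrib_left sum_distrib_right)
  finally show ?thesis .
qed

lemma peval_mval: "peval f A = (\<Sum>p\<in>psupp f. f p * mval A p)"
  by (simp add: peval_def mval_def)

text \<open>Exchanging the sums over variables and over monomials turns the expression of the
  differential condition into \<open>pder\<close>. The assumption \<open>d 0 = 0\<close> keeps the
  support of \<open>pcoeffmap d f\<close> inside that of \<open>f\<close>.\<close>

lemma pder_eq_partials:
  assumes "finite V" "is_poly_over K V f" "d 0 = 0"
  shows "pder d f A B = (\<Sum>v\<in>V. ppartial_eval f v A * B v) + peval (pcoeffmap d f) A"
proof -
  have fin: "finite (psupp f)" and supp: "\<And>p. p \<in> psupp f \<Longrightarrow> {v. p v \<noteq> 0} \<subseteq> V"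
    using assms(2) by (auto simp: is_poly_over_def)
  have "peval (pcoeffmap d f) A = (\<Sum>p\<in>psupp f. d (f p) * mval A p)"
    unfolding peval_mval using fin assms(3)
    by (intro sum.mono_neutral_cong_left) (auto simp: psupp_def pcoeffmap_def)
  moreover have "(\<Sum>v\<in>V. ppartial_eval f v A * B v) = (\<Sum>p\<in>psupp f. f p * dmval A B p)"
  proof -
    have "(\<Sum>v\<in>V. ppartial_eval f v A * B v) =
      (\<Sum>v\<in>V. \<Sum>p\<in>psupp f. f p * of_nat (p v) * A v ^ (p v - 1) * (\<Prod>w\<in>{w. p w \<noteq> 0} - {v}. A w ^ p w) * B v)"
      by (simp add: ppartial_eval_def sum_distrib_right)
    also have "\<dots> = (\<Sum>p\<in>psupp f. \<Sum>v\<in>V. f p * of_nat (p v) * A v ^ (p v - 1) * (\<Prod>w\<in>{w. p w \<noteq> 0} - {v}. A w ^ p w) * B v)"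
      by (rule sum.swap)
    also have "\<dots> = (\<Sum>p\<in>psupp f. f p * dmval A B p)"
    proof (rule sum.cong[OF refl])
      fix p assume p: "p \<in> psupp f"
      have "(\<Sum>v\<in>V. f p * of_nat (p v) * A v ^ (p v - 1) * (\<Prod>w\<in>{w. p w \<noteq> 0} - {v}. A w ^ p w) * B v)
        = (\<Sum>v\<in>{v. p v \<noteq> 0}. f p * of_nat (p v) * A v ^ (p v - 1) * (\<Prod>w\<in>{w. p w \<noteq> 0} - {v}. A w ^ p w) * B v)"
        using assms(1) supp[OF p] by (intro sum.mono_neutral_right) auto
      then show "(\<Sum>v\<in>V. f p * of_nat (p v) * A v ^ (p v - 1) * (\<Prod>w\<in>{w. p w \<noteq> 0} - {v}. A w ^ p w) * B v)
        = f p * dmval A B p"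
        unfolding dmval_def by (simp add: sum_distrib_left mult_ac)
    qed
    finally show ?thesis .
  qed
  ultimately show ?thesis
    unfolding pder_def by (simp add: sum.distrib)
qed

text \<open>A family of terms may repeat a monomial. Adding the coefficients of equal monomials
  gives a genuine polynomial, and additivity of \<open>d\<close> makes \<open>pder\<close> survive
  the merging. Arbitrary index sets allow sums and products of polynomials to be treated
  alike.\<close>

lemma collect_terms:
  assumes K: "is_subfield_set K" and d: "der_on id K d" and I: "finite I"
    and c: "\<And>i. i \<in> I \<Longrightarrow> c i \<in> K"
    and p: "\<And>i. i \<in> I \<Longrightarrow> finite {v. p i v \<noteq> 0} \<and> {v. p i v \<noteq> 0} \<subseteq> V"
  obtains f where "is_poly_over K V f" "peval f A = (\<Sum>i\<in>I. c i * mval A (p i))"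
    "pder d f A B = (\<Sum>i\<in>I. d (c i) * mval A (p i) + c i * dmval A B (p i))"
proof -
  interpret field_hom "id :: 'a \<Rightarrow> 'a" by (rule field_hom_id)
  define f where "f q = (\<Sum>i\<in>{i \<in> I. p i = q}. c i)" for q
  have sub: "psupp f \<subseteq> p ` I"
  proof
    fix q assume "q \<in> psupp f"
    then have "{i \<in> I. p i = q} \<noteq> {}"
      unfolding psupp_def f_def mem_Collect_eq by (metis sum.empty)
    then show "q \<in> p ` I" by blast
  qed
  have d0: "d 0 = 0" by (rule der_zero[OF K d])
  have poly: "is_poly_over K V f"
    unfolding is_poly_over_def
  proof (intro conjI allI ballI)
    show "finite (psupp f)" using sub I by (meson finite_imageI finite_subset)
    show "f q \<in> K" for q unfolding f_def using c by (intro subfield_set_sum[OF K]) auto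
  qed (use sub p in auto)
  have "peval f A = (\<Sum>q\<in>p ` I. f q * mval A q)"
    unfolding peval_mval using sub I by (intro sum.mono_neutral_left) (auto simp: psupp_def)
  also have "\<dots> = (\<Sum>q\<in>p ` I. \<Sum>i\<in>{i \<in> I. p i = q}. c i * mval A (p i))"
    unfolding f_def sum_distrib_right by (intro sum.cong) auto
  also have "\<dots> = (\<Sum>i\<in>I. c i * mval A (p i))"
    by (rule sum.image_gen[OF I, symmetric])
  finally have ev: "peval f A = (\<Sum>i\<in>I. c i * mval A (p i))" .
  have "pder d f A B = (\<Sum>q\<in>p ` I. d (f q) * mval A q + f q * dmval A B q)"
    unfolding pder_def using sub I by (intro sum.mono_neutral_left) (auto simp: psupp_def d0)
  also have "\<dots> = (\<Sum>q\<in>p ` I. \<Sum>i\<in>{i \<in> I. p i = q}. d (c i) * mval A (p i) + c i * dmval A B (p i))"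
  proof (rule sum.cong[OF refl])
    fix q
    have "d (f q) = (\<Sum>i\<in>{i \<in> I. p i = q}. d (c i))"
      unfolding f_def using c by (intro der_sum[OF K d]) auto
    then show "d (f q) * mval A q + f q * dmval A B q =
      (\<Sum>i\<in>{i \<in> I. p i = q}. d (c i) * mval A (p i) + c i * dmval A B (p i))"
      by (simp add: f_def sum.distrib sum_distrib_right)
  qed
  also have "\<dots> = (\<Sum>i\<in>I. d (c i) * mval A (p i) + c i * dmval A B (p i))"
    by (rule sum.image_gen[OF I, symmetric])
  finally show ?thesis using that poly ev by blast
qed

text \<open>The graph of the derivation on the ring of polynomial values is closed under the dual
  number operations; being functional at zero, it extends to fractions by the quotient rule.\<close>

lemma extend_derivation:
  fixes A B :: "'v \<Rightarrow> 'b::field"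
  assumes K: "is_subfield_set K" and d: "der_on id K d"
    and cond: "\<And>f. is_poly_over K V f \<Longrightarrow> peval f A = 0 \<Longrightarrow> pder d f A B = 0"
  obtains D where "der_on id (gen_field (K \<union> A ` V)) D"
    "\<And>c. c \<in> K \<Longrightarrow> D c = d c" "\<And>v. v \<in> V \<Longrightarrow> D (A v) = B v"
proof -
  interpret field_hom "id :: 'b \<Rightarrow> 'b" by (rule field_hom_id)
  note K' = subfield_setD[OF K]
  note poly_def = is_poly_over_def
  define Q where "Q x y \<longleftrightarrow> (\<exists>f. is_poly_over K V f \<and> x = peval f A \<and> y = pder d f A B)" for x y
  have QI: "Q (\<Sum>i\<in>I. c i * mval A (p i)) (\<Sum>i\<in>I. d (c i) * mval A (p i) + c i * dmval A B (p i))"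
    if asm: "finite I" "\<And>i. i \<in> I \<Longrightarrow> c i \<in> K"
      "\<And>i. i \<in> I \<Longrightarrow> finite {v. p i v \<noteq> 0} \<and> {v. p i v \<noteq> 0} \<subseteq> V" for I :: "'i set" and c p
  proof -
    obtain f where "is_poly_over K V f" "peval f A = (\<Sum>i\<in>I. c i * mval A (p i))"
      "pder d f A B = (\<Sum>i\<in>I. d (c i) * mval A (p i) + c i * dmval A B (p i))"
      by (rule collect_terms[OF K d asm])
    then show ?thesis unfolding Q_def by metis
  qed
  have Q0: "y = 0" if "Q 0 y" for y
    using that cond unfolding Q_def by auto
  have Qc: "Q c (d c)" if "c \<in> K" for c
    using QI[of "{()}" "\<lambda>_. c" "\<lambda>_ _. 0"] that by simp
  have Qv: "Q (A v) (B v)" if "v \<in> V" for v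
    using QI[of "{()}" "\<lambda>_. 1" "\<lambda>_ w. if w = v then 1 else 0"] that K'
    by (simp add: mval_single dmval_single der_one[OF K d])
  have Qadd: "Q (x + x') (y + y')" if q: "Q x y" "Q x' y'" for x y x' y'
  proof -
    obtain f where f: "is_poly_over K V f" "x = peval f A" "y = pder d f A B"
      using q(1) unfolding Q_def by blast
    obtain g where g: "is_poly_over K V g" "x' = peval g A" "y' = pder d g A B"
      using q(2) unfolding Q_def by blast
    \<comment> \<open>The disjoint union keeps apart the two occurrences of a monomial common to
      \<open>f\<close> and \<open>g\<close>.\<close>
    let ?I = "psupp f <+> psupp g"
    show ?thesis
      using QI[of ?I "case_sum f g" "case_sum id id"] f g
      by (force simp: poly_def sum.Plus peval_mval pder_def)
  qed
  have Qmult: "Q (x * x') (x * y' + y * x')" if q: "Q x y" "Q x' y'" for x y x' y'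
  proof -
    obtain f where f: "is_poly_over K V f" "x = peval f A" "y = pder d f A B"
      using q(1) unfolding Q_def by blast
    obtain g where g: "is_poly_over K V g" "x' = peval g A" "y' = pder d g A B"
      using q(2) unfolding Q_def by blast
    let ?I = "psupp f \<times> psupp g"
    let ?c = "\<lambda>(p, q). f p * g q" and ?p = "\<lambda>(p :: 'v \<Rightarrow> nat, q) v. p v + q v"
    have fin: "finite (psupp f)" "finite (psupp g)" and
      sf: "\<And>p. p \<in> psupp f \<Longrightarrow> finite {v. p v \<noteq> 0} \<and> {v. p v \<noteq> 0} \<subseteq> V" and
      sg: "\<And>p. p \<in> psupp g \<Longrightarrow> finite {v. p v \<noteq> 0} \<and> {v. p v \<noteq> 0} \<subseteq> V" and
      cK: "\<And>p. f p \<in> K" "\<And>p. g p \<in> K"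
      using f g by (auto simp: poly_def)
    have s: "finite {v. ?p i v \<noteq> 0} \<and> {v. ?p i v \<noteq> 0} \<subseteq> V" if i: "i \<in> ?I" for i
    proof -
      have "{v. ?p i v \<noteq> 0} = {v. fst i v \<noteq> 0} \<union> {v. snd i v \<noteq> 0}"
        by (auto split: prod.splits)
      then show ?thesis using sf[of "fst i"] sg[of "snd i"] i by auto
    qed
    have ev: "(\<Sum>i\<in>?I. ?c i * mval A (?p i)) = x * x'"
    proof -
      have "(\<Sum>i\<in>?I. ?c i * mval A (?p i)) = (\<Sum>(p,q)\<in>?I. (f p * mval A p) * (g q * mval A q))"
        using sf sg by (intro sum.cong) (auto simp: mval_add)
      then show ?thesis unfolding f g peval_mval by (simp add: sum_product sum.cartesian_product)
    qed
    have dv: "(\<Sum>i\<in>?I. d (?c i) * mval A (?p i) + ?c i * dmval A B (?p i)) = x * y' + y * x'"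
    proof -
      have "(\<Sum>i\<in>?I. d (?c i) * mval A (?p i) + ?c i * dmval A B (?p i)) =
        (\<Sum>(p,q)\<in>?I. (f p * mval A p) * (d (g q) * mval A q + g q * dmval A B q)
          + (d (f p) * mval A p + f p * dmval A B p) * (g q * mval A q))"
        using sf sg cK
        by (intro sum.cong) (auto simp: mval_add dmval_add der_mult[OF K d] algebra_simps)
      moreover have "(\<Sum>(p,q)\<in>?I. F p * G' q + F' p * G q) =
        sum F (psupp f) * sum G' (psupp g) + sum F' (psupp f) * sum G (psupp g)"
        for F F' G G' :: "('v \<Rightarrow> nat) \<Rightarrow> 'b"
        by (simp add: sum_product sum.cartesian_product case_prod_unfold flip: sum.distrib)
      ultimately show ?thesis unfolding f g peval_mval pder_def by simp
    qed
    show ?thesis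
      using QI[of ?I ?c ?p] fin cK s unfolding ev dv by (auto intro!: K')
  qed
  have Qneg: "Q (- x) (- y)" if "Q x y" for x y
    using Qmult[OF Qc[of "-1"] that] K' by (simp add: der_minus[OF K d] der_one[OF K d])
  define P where "P z w \<longleftrightarrow> (\<exists>x y u t. Q x y \<and> Q u t \<and> u \<noteq> 0 \<and> z = x / u \<and> w = (y * u - x * t) / (u * u))" for z w
  have PI: "P (x / u) ((y * u - x * t) / (u * u))" if "Q x y" "Q u t" "u \<noteq> 0" for x y u t
    using that unfolding P_def by blast
  have Q1: "Q 1 0" and Qz: "Q 0 0"
    using Qc[of 1] Qc[of 0] K' by (simp_all add: der_one[OF K d] der_zero[OF K d])
  have QP: "P x y" if "Q x y" for x y
    using PI[OF that Q1] by simp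
  have fn: "w = w'" if zw: "P z w" "P z w'" for z w w'
  proof -
    obtain x y u t where 1: "Q x y" "Q u t" "u \<noteq> 0" "z = x / u" "w = (y * u - x * t) / (u * u)"
      using zw(1) unfolding P_def by blast
    obtain x' y' u' t' where 2: "Q x' y'" "Q u' t'" "u' \<noteq> 0" "z = x' / u'" "w' = (y' * u' - x' * t') / (u' * u')"
      using zw(2) unfolding P_def by blast
    have x: "x = z * u" using 1(3,4) by simp
    have x': "x' = z * u'" using 2(3,4) by simp
    \<comment> \<open>The cross-multiplied difference of the two representations of \<open>z\<close>
      is 0, so by \<open>Q0\<close> its derivative is 0 as well; solved for the quotients, this is
      \<open>w = w'\<close>.\<close>
    have "Q (x * u' + - (x' * u)) ((x * t' + y * u') + - (x' * t + y' * u))"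
      by (intro Qadd Qneg Qmult 1 2)
    moreover have "x * u' + - (x' * u) = 0"
      unfolding x x' by (simp add: mult_ac)
    ultimately have "(x * t' + y * u') + - (x' * t + y' * u) = 0"
      using Q0 by metis
    then have "x * t' + y * u' = x' * t + y' * u"
      by (metis add_uminus_conv_diff right_minus_eq)
    then have *: "(y - z * t) * u' = (y' - z * t') * u"
      unfolding x x' by (simp add: algebra_simps)
    have "w = (y - z * t) / u" "w' = (y' - z * t') / u'"
      unfolding 1(5) 2(5) x x' using 1(3) 2(3) by (simp_all add: field_simps)
    then show ?thesis using * 1(3) 2(3) by (simp add: frac_eq_eq)
  qed
  have Padd: "P (z + z') (w + w')" if zw: "P z w" "P z' w'" for z w z' w'
  proof -
    obtain x y u t where 1: "Q x y" "Q u t" "u \<noteq> 0" "z = x / u" "w = (y * u - x * t) / (u * u)"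
      using zw(1) unfolding P_def by blast
    obtain x' y' u' t' where 2: "Q x' y'" "Q u' t'" "u' \<noteq> 0" "z' = x' / u'" "w' = (y' * u' - x' * t') / (u' * u')"
      using zw(2) unfolding P_def by blast
    have "P ((x * u' + x' * u) / (u * u'))
      ((((x * t' + y * u') + (x' * t + y' * u)) * (u * u') - (x * u' + x' * u) * (u * t' + t * u')) / ((u * u') * (u * u')))"
      using 1(3) 2(3) by (intro PI Qadd Qmult 1 2) auto
    moreover have "(x * u' + x' * u) / (u * u') = z + z'"
      unfolding 1(4) 2(4) using 1(3) 2(3) by (simp add: add_frac_eq)
    moreover have "(((x * t' + y * u') + (x' * t + y' * u)) * (u * u') - (x * u' + x' * u) * (u * t' + t * u')) / ((u * u') * (u * u')) = w + w'"
      unfolding 1(5) 2(5) using 1(3) 2(3) by (simp add: divide_simps) (simp add: algebra_simps)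
    ultimately show ?thesis by simp
  qed
  have Pmult: "P (z * z') (z * w' + w * z')" if zw: "P z w" "P z' w'" for z w z' w'
  proof -
    obtain x y u t where 1: "Q x y" "Q u t" "u \<noteq> 0" "z = x / u" "w = (y * u - x * t) / (u * u)"
      using zw(1) unfolding P_def by blast
    obtain x' y' u' t' where 2: "Q x' y'" "Q u' t'" "u' \<noteq> 0" "z' = x' / u'" "w' = (y' * u' - x' * t') / (u' * u')"
      using zw(2) unfolding P_def by blast
    have "P ((x * x') / (u * u'))
      (((x * y' + y * x') * (u * u') - (x * x') * (u * t' + t * u')) / ((u * u') * (u * u')))"
      using 1(3) 2(3) by (intro PI Qadd Qmult 1 2) auto
    moreover have "((x * y' + y * x') * (u * u') - (x * x') * (u * t' + t * u')) / ((u * u') * (u * u')) = z * w' + w * z'"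
      unfolding 1(4,5) 2(4,5) using 1(3) 2(3) by (simp add: divide_simps) (simp add: algebra_simps)
    ultimately show ?thesis unfolding 1(4) 2(4) by simp
  qed
  have Pinv: "\<exists>w'. P (inverse z) w'" if zw: "P z w" for z w
  proof -
    obtain x y u t where 1: "Q x y" "Q u t" "u \<noteq> 0" "z = x / u" "w = (y * u - x * t) / (u * u)"
      using zw(1) unfolding P_def by blast
    show ?thesis
    proof (cases "x = 0")
      case True
      then show ?thesis using QP[OF Qz] 1(4) by auto
    next
      case False
      then show ?thesis using PI[OF 1(2,1)] 1(4) by auto
    qed
  qed
  have "is_subfield_set {z. \<exists>w. P z w}"
    unfolding is_subfield_set_def
  proof (intro conjI ballI)
    show "0 \<in> {z. \<exists>w. P z w}" "1 \<in> {z. \<exists>w. P z w}"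
      using QP Q1 Qz by blast+
    fix x assume x: "x \<in> {z. \<exists>w. P z w}"
    show "inverse x \<in> {z. \<exists>w. P z w}" using x Pinv by blast
    fix y assume y: "y \<in> {z. \<exists>w. P z w}"
    show "x + y \<in> {z. \<exists>w. P z w}" "x * y \<in> {z. \<exists>w. P z w}"
      using x y Padd Pmult by blast+
    have "\<exists>w. P (- y) w"
      using Pmult[OF QP[OF Qneg[OF Q1]]] y by fastforce
    then show "x - y \<in> {z. \<exists>w. P z w}"
      using x Padd[of x _ "- y"] by fastforce
  qed
  moreover have "K \<union> A ` V \<subseteq> {z. \<exists>w. P z w}"
    using Qc Qv QP by blast
  ultimately have dom: "gen_field (K \<union> A ` V) \<subseteq> {z. \<exists>w. P z w}"
    by (rule gen_field_least)
  define D where "D z = (THE w. P z w)" for z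
  have DI: "D z = w" if "P z w" for z w
    unfolding D_def using that fn by blast
  have "der_on id (gen_field (K \<union> A ` V)) D"
    unfolding der_on_def id_apply
  proof (intro ballI)
    fix x y assume "x \<in> gen_field (K \<union> A ` V)" "y \<in> gen_field (K \<union> A ` V)"
    then obtain w w' where "P x w" "P y w'" using dom by blast
    then show "D (x + y) = D x + D y \<and> D (x * y) = x * D y + D x * y"
      using DI Padd Pmult by metis
  qed
  then show ?thesis
    using that DI QP Qc Qv by metis
qed

section \<open>Rational functions and linear relations\<close>

type_synonym 'a ratfun = "((nat \<Rightarrow>\<^sub>0 nat) \<Rightarrow>\<^sub>0 'a) fract"

definition rf_const :: "'a::field \<Rightarrow> 'a ratfun" where
  "rf_const c = Fract (Poly_Mapping.single 0 c) 1"

definition rf_var :: "nat \<Rightarrow> 'a::field ratfun" where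
  "rf_var j = Fract (Poly_Mapping.single (Poly_Mapping.single j 1) 1) 1"

lemma field_hom_rf_const: "field_hom rf_const"
  by unfold_locales
    (simp_all add: rf_const_def single_add Poly_Mapping.mult_single One_fract_def)

lemma Fract_1_sum: "(\<Sum>i\<in>I. Fract (f i) 1) = Fract (sum f I) 1"
  by (induction I rule: infinite_finite_induct) (auto simp: Zero_fract_def)

lemma rf_var_power: "rf_var j ^ i = Fract (Poly_Mapping.single (Poly_Mapping.single j i) 1) 1"
  by (induction i)
    (simp_all add: rf_var_def One_fract_def Poly_Mapping.mult_single flip: single_add)

lemma rf_var_monomial:
  "finite S \<Longrightarrow> (\<Prod>v\<in>S. rf_var (code v) ^ p v) =
     Fract (Poly_Mapping.single (\<Sum>v\<in>S. Poly_Mapping.single (code v) (p v)) 1) 1"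
  by (induction S rule: finite_induct)
    (simp_all add: rf_var_power One_fract_def Poly_Mapping.mult_single)

text \<open>Injectivity of \<open>code\<close> on \<open>V\<close> makes different exponents of
  \<open>f\<close> give different monomials, so after clearing the trivial denominators each
  coefficient can be read off the sum.\<close>

lemma rf_var_independent:
  fixes f :: "('v \<Rightarrow> nat) \<Rightarrow> 'a::field ratfun"
  assumes f: "is_poly_over (range rf_const) V f" and code: "inj_on code V"
    and ev: "peval f (\<lambda>v. rf_var (code v)) = 0"
  shows "f p = 0"
proof (rule ccontr)
  assume "f p \<noteq> 0"
  then have p: "p \<in> psupp f" by (simp add: psupp_def)
  have fin: "finite (psupp f)"
    and supp: "\<And>p. p \<in> psupp f \<Longrightarrow> finite {v. p v \<noteq> 0} \<and> {v. p v \<noteq> 0} \<subseteq> V"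
    using f by (auto simp: is_poly_over_def)
  define c where "c q = (SOME c. f q = rf_const c)" for q
  have c: "f q = rf_const (c q)" for q
  proof -
    have "f q \<in> range rf_const" using f unfolding is_poly_over_def by blast
    then have "\<exists>c. f q = rf_const c" by blast
    from someI_ex[OF this] show ?thesis unfolding c_def .
  qed
  \<comment> \<open>The exponent \<open>q\<close> renamed along \<open>code\<close>;
    \<open>look\<close> recovers \<open>q\<close> from it on \<open>V\<close>.\<close>
  define \<mu> :: "('v \<Rightarrow> nat) \<Rightarrow> nat \<Rightarrow>\<^sub>0 nat"
    where "\<mu> q = (\<Sum>v\<in>{v. q v \<noteq> 0}. Poly_Mapping.single (code v) (q v))" for q
  have look: "Poly_Mapping.lookup (\<mu> q) (code v) = q v" if q: "q \<in> psupp f" and v: "v \<in> V" for q v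
  proof -
    have "Poly_Mapping.lookup (\<mu> q) (code v) = (\<Sum>w\<in>{w. q w \<noteq> 0}. if w = v then q w else 0)"
      unfolding \<mu>_def lookup_sum lookup_single when_def
      using supp[OF q] v inj_onD[OF code] by (intro sum.cong) auto
    also have "\<dots> = q v"
      using supp[OF q] by (simp add: sum.delta)
    finally show ?thesis .
  qed
  have inj: "q = q'" if "q \<in> psupp f" "q' \<in> psupp f" "\<mu> q = \<mu> q'" for q q'
  proof
    fix v show "q v = q' v"
    proof (cases "v \<in> V")
      case True
      then show ?thesis using look that by metis
    next
      case False
      then have "q v = 0" "q' v = 0" using supp[OF that(1)] supp[OF that(2)] by auto
      then show ?thesis by simp
    qed
  qed
  have "0 = (\<Sum>q\<in>psupp f. rf_const (c q) * Fract (Poly_Mapping.single (\<mu> q) 1) 1)"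
    unfolding ev[symmetric] peval_def using supp
    by (intro sum.cong) (auto simp: c rf_var_monomial \<mu>_def)
  also have "\<dots> = Fract (\<Sum>q\<in>psupp f. Poly_Mapping.single (\<mu> q) (c q)) 1"
    by (simp add: rf_const_def Poly_Mapping.mult_single flip: Fract_1_sum)
  finally have "(\<Sum>q\<in>psupp f. Poly_Mapping.single (\<mu> q) (c q)) = 0"
    by (simp add: Zero_fract_def eq_fract)
  then have "0 = Poly_Mapping.lookup (\<Sum>q\<in>psupp f. Poly_Mapping.single (\<mu> q) (c q)) (\<mu> p)"
    by simp
  also have "\<dots> = (\<Sum>q\<in>psupp f. if q = p then c q else 0)"
    unfolding lookup_sum lookup_single when_def using inj p by (intro sum.cong) auto
  also have "\<dots> = c p" using fin p by simp
  finally have "c p = 0" by simp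
  then have "f p = 0"
    using c[of p] field_hom.hom_zero[OF field_hom_rf_const] by metis
  with \<open>f p \<noteq> 0\<close> show False by simp
qed

section \<open>An injection of rational functions into lists over the base field\<close>

definition pm_list :: "('k \<Rightarrow> nat) \<Rightarrow> ('k \<Rightarrow>\<^sub>0 'v::zero) \<Rightarrow> ('v \<times> nat) list" where
  "pm_list c p = map (\<lambda>k. (Poly_Mapping.lookup p k, c k)) (SOME ks. set ks = Poly_Mapping.keys p)"

text \<open>The list shows exactly the nonzero values together with their keys, and a missing key
  means the value 0. The arbitrary order of the keys does no harm, as only the set of entries is
  compared.\<close>

lemma inj_pm_list:
  fixes c :: "'k \<Rightarrow> nat"
  assumes "inj c" shows "inj (pm_list c :: ('k \<Rightarrow>\<^sub>0 'v::zero) \<Rightarrow> _)"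
proof (rule injI)
  fix p q :: "'k \<Rightarrow>\<^sub>0 'v" assume eq: "pm_list c p = pm_list c q"
  have set: "(y, c k) \<in> set (pm_list c p) \<longleftrightarrow> y = Poly_Mapping.lookup p k \<and> y \<noteq> 0" for y k and p :: "'k \<Rightarrow>\<^sub>0 'v"
  proof -
    have "set (SOME ks. set ks = Poly_Mapping.keys p) = Poly_Mapping.keys p"
      using finite_list[OF finite_keys[of p]] by (rule someI_ex)
    then show ?thesis
      using assms by (auto simp: pm_list_def inj_eq in_keys_iff)
  qed
  show "p = q"
  proof (rule poly_mapping_eqI)
    fix k show "Poly_Mapping.lookup p k = Poly_Mapping.lookup q k"
      using set[of "Poly_Mapping.lookup p k" k p] set[of "Poly_Mapping.lookup q k" k q] set[of "Poly_Mapping.lookup p k" k q]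
        set[of "Poly_Mapping.lookup q k" k p] eq by metis
  qed
qed

text \<open>The number is written in unary and terminated by a zero, which makes the code of a pair
  self-delimiting.\<close>

fun list_code :: "('a::field \<times> nat) list \<Rightarrow> 'a list" where
  "list_code [] = []"
| "list_code ((c, k) # xs) = replicate k 1 @ [0, c] @ list_code xs"

lemma replicate_delim:
  "replicate k (1::'a::field) @ 0 # xs = replicate k' 1 @ 0 # ys \<Longrightarrow> k = k' \<and> xs = ys"
proof (induction k arbitrary: k')
  case 0 then show ?case by (cases k') auto
next
  case (Suc k) then show ?case by (cases k') auto
qed

lemma inj_list_code: "inj list_code"
proof (rule injI)
  fix xs ys :: "('a \<times> nat) list"
  show "list_code xs = list_code ys \<Longrightarrow> xs = ys"
  proof (induction xs arbitrary: ys rule: list_code.induct)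
    case 1 then show ?case by (cases ys rule: list_code.cases) auto
  next
    case (2 c k xs)
    then show ?case
      by (cases ys rule: list_code.cases) (auto dest!: replicate_delim)
  qed
qed

text \<open>The theorem asks for a field carried by \<open>'a list\<close>. A rational function is
  recorded there through a chosen numerator and denominator, whose monomials are numbered by the
  countability of exponents.\<close>

lemma ratfun_code: "\<exists>\<iota> :: 'a::field ratfun \<Rightarrow> 'a list. inj \<iota>"
proof -
  define c :: "(nat \<Rightarrow>\<^sub>0 nat) \<Rightarrow> nat" where "c = to_nat \<circ> pm_list (\<lambda>k. k)"
  have c: "inj c"
    unfolding c_def by (intro inj_compose inj_pm_list inj_to_nat) auto
  define num :: "'a ratfun \<Rightarrow> _" where "num q = (SOME ab. snd ab \<noteq> 0 \<and> q = Fract (fst ab) (snd ab))" for q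
  have num: "q = Fract (fst (num q)) (snd (num q))" for q
  proof -
    have "\<exists>ab. snd ab \<noteq> 0 \<and> q = Fract (fst ab) (snd ab)"
      by (cases q) auto
    from someI_ex[OF this] show ?thesis unfolding num_def by blast
  qed
  \<comment> \<open>The leading entry stores the length of the numerator list, so that the
    concatenation can be split again.\<close>
  define \<iota> where "\<iota> q = (let p1 = pm_list c (fst (num q)); p2 = pm_list c (snd (num q))
    in list_code ((0, length p1) # p1 @ p2))" for q
  have "inj \<iota>"
  proof (rule injI)
    fix q q' assume "\<iota> q = \<iota> q'"
    then have "pm_list c (fst (num q)) = pm_list c (fst (num q'))"
      "pm_list c (snd (num q)) = pm_list c (snd (num q'))"
      by (auto simp: \<iota>_def Let_def simp del: list_code.simps dest!: injD[OF inj_list_code])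
    then have "num q = num q'"
      using injD[OF inj_pm_list[OF c]] by (intro prod_eqI) blast+
    then show "q = q'" using num by metis
  qed
  then show ?thesis by blast
qed

section \<open>Spans of \<open>1\<close> and given vectors, and the lifting of linear
  relations\<close>

definition lspan :: "'a::field set \<Rightarrow> ('v \<Rightarrow> 'a) \<Rightarrow> 'v set \<Rightarrow> 'a set" where
  "lspan F a U = {c0 + (\<Sum>w\<in>U. c w * a w) | c0 c. c0 \<in> F \<and> (\<forall>w. c w \<in> F)}"

lemma lspanI: "c0 \<in> F \<Longrightarrow> (\<And>w. c w \<in> F) \<Longrightarrow> c0 + (\<Sum>w\<in>U. c w * a w) \<in> lspan F a U"
  unfolding lspan_def by blast

context
  fixes F :: "'a::field set" assumes F: "is_subfield_set F"
begin

lemma lspan_base: "x \<in> F \<Longrightarrow> x \<in> lspan F a U"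
  using lspanI[of x F "\<lambda>_. 0" a U] subfield_setD[OF F] by simp

lemma lspan_gen: 
  assumes "finite U" "v \<in> U" shows "a v \<in> lspan F a U"
proof -
  have "(\<Sum>w\<in>U. (if w = v then 1 else 0) * a w) = (\<Sum>w\<in>U. if w = v then a w else 0)"
    by (intro sum.cong) auto
  also have "\<dots> = a v" using assms by simp
  finally show ?thesis
    using lspanI[of 0 F "\<lambda>w. if w = v then 1 else 0" a U] subfield_setD[OF F] by simp
qed

lemma lspan_add:
  assumes "x \<in> lspan F a U" "y \<in> lspan F a U"
  shows "x + y \<in> lspan F a U"
proof -
  obtain c0 c where x: "x = c0 + (\<Sum>w\<in>U. c w * a w)" "c0 \<in> F" "\<And>w. c w \<in> F"
    using assms(1) unfolding lspan_def by blast
  obtain b0 b where y: "y = b0 + (\<Sum>w\<in>U. b w * a w)" "b0 \<in> F" "\<And>w. b w \<in> F"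
    using assms(2) unfolding lspan_def by blast
  have "x + y = (c0 + b0) + (\<Sum>w\<in>U. (c w + b w) * a w)"
    unfolding x y by (simp add: algebra_simps sum.distrib)
  also have "\<dots> \<in> lspan F a U"
    using x y subfield_setD[OF F] by (intro lspanI) auto
  finally show ?thesis .
qed

lemma lspan_scale:
  assumes "x \<in> lspan F a U" "s \<in> F"
  shows "s * x \<in> lspan F a U"
proof -
  obtain c0 c where x: "x = c0 + (\<Sum>w\<in>U. c w * a w)" "c0 \<in> F" "\<And>w. c w \<in> F"
    using assms(1) unfolding lspan_def by blast
  have "s * x = s * c0 + (\<Sum>w\<in>U. (s * c w) * a w)"
    unfolding x by (simp add: algebra_simps sum_distrib_left)
  also have "\<dots> \<in> lspan F a U"
    using x assms(2) subfield_setD[OF F] by (intro lspanI) auto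
  finally show ?thesis .
qed

end

text \<open>A greedy choice along \<open>rk\<close>: a vector outside the span of \<open>1\<close>
  and its predecessors occurs in no new relation and may be sent to the prescribed
  \<open>x v\<close>, while any other has its image forced by one expression through its
  predecessors. All relations that are linear with a constant term are then preserved; algebraic
  ones need not be.\<close>

lemma linear_lift:
  fixes e :: "'a::field \<Rightarrow> 'b::field" and a :: "'v \<Rightarrow> 'a" and x :: "'v \<Rightarrow> 'b" and rk :: "'v \<Rightarrow> nat"
  assumes e: "field_hom e" and F: "is_subfield_set F" and T: "finite T" "inj_on rk T"
  shows "\<exists>A. (\<forall>v\<in>T. a v \<notin> lspan F a {w\<in>T. rk w < rk v} \<longrightarrow> A v = x v) \<and>
    (\<forall>v\<in>T. a v \<in> lspan F a {w\<in>T. rk w < rk v} \<longrightarrow> A v \<in> lspan (e ` F) A {w\<in>T. rk w < rk v}) \<and>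
    (\<forall>c0 c. c0 \<in> F \<longrightarrow> (\<forall>w. c w \<in> F) \<longrightarrow> c0 + (\<Sum>v\<in>T. c v * a v) = 0 \<longrightarrow>
       e c0 + (\<Sum>v\<in>T. e (c v) * A v) = 0)"
  using T
proof (induction T rule: finite_ranking_induct[where f = rk])
  case empty
  then show ?case using field_hom.hom_zero[OF e] by auto
next
  case (insert u T)
  interpret field_hom e by (rule e)
  note F' = subfield_setD[OF F]
  show ?case
  proof (cases "u \<in> T")
    case True
    then show ?thesis using insert by (simp add: insert_absorb)
  next
    case False
    have lt: "rk v < rk u" if "v \<in> T" for v
      using insert(2)[OF that] insert(4) that False
      by (metis inj_on_eq_iff insert_iff le_neq_implies_less)
    then have low: "{w \<in> insert u T. rk w < rk v} = {w \<in> T. rk w < rk v}" if "v \<in> T" for v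
      using that by force
    have lowu: "{w \<in> insert u T. rk w < rk u} = T"
      using lt by force
    obtain A where A: "(\<forall>v\<in>T. a v \<notin> lspan F a {w\<in>T. rk w < rk v} \<longrightarrow> A v = x v) \<and>
      (\<forall>v\<in>T. a v \<in> lspan F a {w\<in>T. rk w < rk v} \<longrightarrow> A v \<in> lspan (e ` F) A {w\<in>T. rk w < rk v}) \<and>
      (\<forall>c0 c. c0 \<in> F \<longrightarrow> (\<forall>w. c w \<in> F) \<longrightarrow> c0 + (\<Sum>v\<in>T. c v * a v) = 0 \<longrightarrow>
        e c0 + (\<Sum>v\<in>T. e (c v) * A v) = 0)"
      using insert(3)[OF inj_on_subset[OF insert(4) subset_insertI]] by (rule exE)
    have A1: "\<And>v. v \<in> T \<Longrightarrow> a v \<notin> lspan F a {w\<in>T. rk w < rk v} \<Longrightarrow> A v = x v"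
      and A2: "\<And>v. v \<in> T \<Longrightarrow> a v \<in> lspan F a {w\<in>T. rk w < rk v} \<Longrightarrow> A v \<in> lspan (e ` F) A {w\<in>T. rk w < rk v}"
      and A3: "\<And>c0 c. c0 \<in> F \<Longrightarrow> (\<And>w. c w \<in> F) \<Longrightarrow> c0 + (\<Sum>v\<in>T. c v * a v) = 0 \<Longrightarrow>
       e c0 + (\<Sum>v\<in>T. e (c v) * A v) = 0"
      using A by blast+
    have sumT: "(\<Sum>v\<in>T. g v * (A(u := z)) v) = (\<Sum>v\<in>T. g v * A v)" for g z
      using False by (intro sum.cong) auto
    have spanT: "lspan (e ` F) (A(u := z)) {w\<in>T. rk w < k} = lspan (e ` F) A {w\<in>T. rk w < k}" for z k
    proof -
      have "(\<Sum>w\<in>{w\<in>T. rk w < k}. c w * (A(u := z)) w) = (\<Sum>w\<in>{w\<in>T. rk w < k}. c w * A w)" for c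
        using False by (intro sum.cong) auto
      then show ?thesis unfolding lspan_def by simp
    qed
    have old: "a v \<notin> lspan F a {w\<in>insert u T. rk w < rk v} \<Longrightarrow> (A(u := z)) v = x v"
      "a v \<in> lspan F a {w\<in>insert u T. rk w < rk v} \<Longrightarrow>
        (A(u := z)) v \<in> lspan (e ` F) (A(u := z)) {w\<in>insert u T. rk w < rk v}" if "v \<in> T" for v z
      using that A1[of v] A2[of v] False unfolding low[OF that] spanT by auto
    show ?thesis
    proof (cases "a u \<in> lspan F a T")
      case True
      then obtain b0 b where b: "a u = b0 + (\<Sum>w\<in>T. b w * a w)" "b0 \<in> F" "\<And>w. b w \<in> F"
        unfolding lspan_def by blast
      define z where "z = e b0 + (\<Sum>w\<in>T. e (b w) * A w)"
      have rel: "e c0 + (\<Sum>v\<in>insert u T. e (c v) * (A(u := z)) v) = 0"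
        if "c0 \<in> F" "\<forall>w. c w \<in> F" "c0 + (\<Sum>v\<in>insert u T. c v * a v) = 0" for c0 c
      proof -
        \<comment> \<open>Substituting the chosen expression of \<open>a u\<close> turns any
          relation on \<open>insert u T\<close> into one on \<open>T\<close>, where the induction
          hypothesis applies.\<close>
        have "(c0 + c u * b0) + (\<Sum>v\<in>T. (c v + c u * b v) * a v) = 0"
          using that(3) False insert(1) b(1)
          by (simp add: algebra_simps sum.distrib sum_distrib_left)
        then have "e (c0 + c u * b0) + (\<Sum>v\<in>T. e (c v + c u * b v) * A v) = 0"
          using that F' b by (intro A3) auto
        then show ?thesis
          using False insert(1) sumT[of "\<lambda>v. e (c v)"] unfolding z_def
          by (simp add: hom_add hom_mult algebra_simps sum.distrib sum_distrib_left)
      qed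
      have zs: "z \<in> lspan (e ` F) (A(u := z)) {w\<in>insert u T. rk w < rk u}"
        unfolding lowu using b lspanI[of "e b0" "e ` F" "\<lambda>w. e (b w)" "A(u := z)" T]
        unfolding sumT by (simp add: z_def)
      have zs': "(A(u := z)) u \<in> lspan (e ` F) (A(u := z)) {w\<in>insert u T. rk w < rk u}"
        unfolding fun_upd_same by (rule zs)
      show ?thesis
      proof (intro exI[of _ "A(u := z)"] conjI ballI impI allI)
        fix v assume v: "v \<in> insert u T"
        show "(A(u := z)) v = x v" if "a v \<notin> lspan F a {w\<in>insert u T. rk w < rk v}"
          using v that old(1) True lowu by (metis insertE)
        show "(A(u := z)) v \<in> lspan (e ` F) (A(u := z)) {w\<in>insert u T. rk w < rk v}"
          if "a v \<in> lspan F a {w\<in>insert u T. rk w < rk v}"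
          using v that old(2)[of v z] zs' by (cases "v = u") blast+
      qed (use rel in blast)
    next
      case nin: False
      have rel: "e c0 + (\<Sum>v\<in>insert u T. e (c v) * (A(u := x u)) v) = 0"
        if c: "c0 \<in> F" "\<forall>w. c w \<in> F" "c0 + (\<Sum>v\<in>insert u T. c v * a v) = 0" for c0 c
      proof -
        \<comment> \<open>Dividing by a nonzero coefficient would put \<open>a u\<close> into the
          span of \<open>T\<close>.\<close>
        have cu: "c u = 0"
        proof (rule ccontr)
          assume cu: "c u \<noteq> 0"
          have "c u * a u = - c0 + (\<Sum>v\<in>T. - c v * a v)"
            using c(3) False insert(1) by (simp add: sum_negf algebra_simps eq_neg_iff_add_eq_0)
          then have "c u * a u \<in> lspan F a T"
            using lspanI[of "- c0" F "\<lambda>v. - c v" a T] c F' by simp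
          from lspan_scale[OF F this, of "inverse (c u)"] have "a u \<in> lspan F a T"
            using cu c F' by (simp add: mult.assoc[symmetric])
          then show False using nin by simp
        qed
        then have "c0 + (\<Sum>v\<in>T. c v * a v) = 0"
          using c(3) False insert(1) by simp
        then have "e c0 + (\<Sum>v\<in>T. e (c v) * A v) = 0"
          using A3 c by blast
        then show ?thesis
          using False insert(1) sumT[of "\<lambda>v. e (c v)"] cu by (simp add: hom_zero)
      qed
      show ?thesis
      proof (intro exI[of _ "A(u := x u)"] conjI ballI impI allI)
        fix v assume v: "v \<in> insert u T"
        show "(A(u := x u)) v = x v" if "a v \<notin> lspan F a {w\<in>insert u T. rk w < rk v}"
          using v that old(1) by (metis insertE fun_upd_same)
        show "(A(u := x u)) v \<in> lspan (e ` F) (A(u := x u)) {w\<in>insert u T. rk w < rk v}"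
          if "a v \<in> lspan F a {w\<in>insert u T. rk w < rk v}"
          using v that old(2)[of v "x u"] nin lowu by (cases "v = u") auto
      qed (use rel in blast)
    qed
  qed
qed

section \<open>The order on indices\<close>

definition lexlt :: "nat \<Rightarrow> (nat \<Rightarrow> nat) \<Rightarrow> (nat \<Rightarrow> nat) \<Rightarrow> bool" where
  "lexlt l \<xi> \<eta> \<longleftrightarrow> (\<exists>j<l. (\<forall>i<j. \<xi> i = \<eta> i) \<and> \<xi> j < \<eta> j)"

lemma lexlt_trans:
  assumes "lexlt l \<xi> \<eta>" "lexlt l \<eta> \<zeta>" shows "lexlt l \<xi> \<zeta>"
proof -
  obtain j where j: "j < l" "\<And>i. i < j \<Longrightarrow> \<xi> i = \<eta> i" "\<xi> j < \<eta> j"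
    using assms(1) unfolding lexlt_def by blast
  obtain j' where j': "j' < l" "\<And>i. i < j' \<Longrightarrow> \<eta> i = \<zeta> i" "\<eta> j' < \<zeta> j'"
    using assms(2) unfolding lexlt_def by blast
  have "\<xi> (min j j') < \<zeta> (min j j')"
  proof (cases j j' rule: linorder_cases)
    case less
    then show ?thesis using j(3) j'(2)[of j] by simp
  next
    case equal
    then show ?thesis using j(3) j'(3) by simp
  next
    case greater
    then show ?thesis using j(2)[of j'] j'(3) by simp
  qed
  moreover have "\<forall>i<min j j'. \<xi> i = \<zeta> i" using j(2) j'(2) by simp
  ultimately show ?thesis unfolding lexlt_def using j(1) by (intro exI[of _ "min j j'"]) simp
qed

lemma lexlt_irrefl: "\<not> lexlt l \<xi> \<xi>"
  by (simp add: lexlt_def)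

lemma lexlt_total:
  assumes "i < l" "\<xi> i \<noteq> \<eta> i" shows "lexlt l \<xi> \<eta> \<or> lexlt l \<eta> \<xi>"
proof -
  define j where "j = (LEAST i. \<xi> i \<noteq> \<eta> i)"
  have "\<xi> j \<noteq> \<eta> j" "j \<le> i" "\<And>i. i < j \<Longrightarrow> \<xi> i = \<eta> i"
    unfolding j_def using assms(2) LeastI[of "\<lambda>i. \<xi> i \<noteq> \<eta> i"] Least_le[of "\<lambda>i. \<xi> i \<noteq> \<eta> i"]
      not_less_Least[of _ "\<lambda>i. \<xi> i \<noteq> \<eta> i"] by blast+
  then show ?thesis unfolding lexlt_def using assms(1) by (metis linorder_neqE_nat order_le_less_trans)
qed

lemma lexle_iff: "lexle l \<xi> \<eta> \<longleftrightarrow> (\<forall>i<l. \<xi> i = \<eta> i) \<or> lexlt l \<xi> \<eta>"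
  by (simp add: lexle_def lexlt_def)

section \<open>Indices of generators: size, shift and rank\<close>

type_synonym index = "(nat \<Rightarrow> nat) \<times> nat"

definition idx :: "nat \<Rightarrow> nat \<Rightarrow> index set" where
  "idx m n = NN m \<times> {..<n}"

definition sz :: "nat \<Rightarrow> index \<Rightarrow> nat" where
  "sz m v = msize m (fst v)"

definition shift :: "nat \<Rightarrow> index \<Rightarrow> index" where
  "shift i v = (madd (fst v) (eps i), snd v)"

text \<open>Each index has finitely many predecessors, since their size is bounded by its own.
  Counting them makes the order a measure, ready for recursion and induction.\<close>

definition rk :: "nat \<Rightarrow> nat \<Rightarrow> index \<Rightarrow> nat" where
  "rk m n v = card {w \<in> idx m n. tlt m w v}"

lemma shift_commute: "shift i (shift j v) = shift j (shift i v)"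
  by (auto simp: shift_def madd_def)

lemma shift_inj: "shift i v = shift i w \<Longrightarrow> v = w"
  by (auto simp: shift_def madd_def prod_eq_iff fun_eq_iff)

lemma msize_madd_eps: "i < m \<Longrightarrow> msize m (madd \<xi> (eps i)) = msize m \<xi> + 1"
  by (simp add: msize_def madd_def eps_def sum.distrib)

lemma sz_shift: "i < m \<Longrightarrow> sz m (shift i v) = Suc (sz m v)"
  by (simp add: sz_def shift_def msize_madd_eps)

lemma shift_idx: "i < m \<Longrightarrow> v \<in> idx m n \<Longrightarrow> shift i v \<in> idx m n"
  by (auto simp: idx_def shift_def NN_def madd_def eps_def)

lemma finite_sz_le: "finite {v \<in> idx m n. sz m v \<le> N}"
proof -
  have "{\<xi> \<in> NN m. msize m \<xi> \<le> N} \<subseteq> {\<xi>. \<forall>i. (i \<in> {..<m} \<longrightarrow> \<xi> i \<in> {..N}) \<and> (i \<notin> {..<m} \<longrightarrow> \<xi> i = 0)}"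
  proof safe
    fix \<xi> i assume "msize m \<xi> \<le> N" "i < m"
    then show "\<xi> i \<le> N"
      using member_le_sum[of i "{..<m}" \<xi>] by (simp add: msize_def)
  qed (auto simp: NN_def, metis leI less_numeral_extra(3))
  then have "finite {\<xi> \<in> NN m. msize m \<xi> \<le> N}"
    by (rule finite_subset) (rule finite_set_of_finite_funs; simp)
  then have "finite ({\<xi> \<in> NN m. msize m \<xi> \<le> N} \<times> {..<n})" by simp
  then show ?thesis
    by (rule finite_subset[rotated]) (auto simp: idx_def sz_def)
qed

context
  fixes m n :: nat
  assumes m: "m > 0"
begin

text \<open>The last coordinate is the size minus the others. Hence comparing the first
  \<open>m - 1\<close> coordinates is enough for a total order.\<close>

lemma NN_eqI:
  assumes "\<xi> \<in> NN m" "\<eta> \<in> NN m" "msize m \<xi> = msize m \<eta>" "\<forall>i<m-1. \<xi> i = \<eta> i"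
  shows "\<xi> = \<eta>"
proof
  fix i
  have "msize m \<zeta> = (\<Sum>i<m-1. \<zeta> i) + \<zeta> (m - 1)" for \<zeta>
    using m sum.lessThan_Suc[of \<zeta> "m - 1"] by (simp add: msize_def)
  then have last: "\<xi> (m - 1) = \<eta> (m - 1)"
    using assms(3,4) by simp
  consider "i < m - 1" | "i = m - 1" | "i \<ge> m" using m by linarith
  then show "\<xi> i = \<eta> i"
    using assms last by cases (auto simp: NN_def)
qed

lemma tlt_iff:
  assumes "v \<in> idx m n" "w \<in> idx m n"
  shows "tlt m v w \<longleftrightarrow> sz m v < sz m w \<or>
    (sz m v = sz m w \<and> (snd v < snd w \<or> (snd v = snd w \<and> lexlt (m - 1) (fst v) (fst w))))"
  using assms NN_eqI[of "fst v" "fst w"]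
  by (cases v; cases w) (auto simp: tlt_def tle_def lexle_iff sz_def idx_def lexlt_irrefl)

lemma tlt_trans:
  assumes "u \<in> idx m n" "v \<in> idx m n" "w \<in> idx m n" "tlt m u v" "tlt m v w"
  shows "tlt m u w"
  using assms(4,5) lexlt_trans[of "m - 1" "fst u" "fst v" "fst w"]
  by (auto simp: tlt_iff assms(1-3))

lemma tlt_total:
  assumes "v \<in> idx m n" "w \<in> idx m n" "v \<noteq> w"
  shows "tlt m v w \<or> tlt m w v"
proof -
  have "lexlt (m - 1) (fst v) (fst w) \<or> lexlt (m - 1) (fst w) (fst v)"
    if "sz m v = sz m w" "snd v = snd w"
  proof -
    have "\<exists>i<m - 1. fst v i \<noteq> fst w i"
      using NN_eqI[of "fst v" "fst w"] assms that by (force simp: idx_def sz_def prod_eq_iff)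
    then show ?thesis using lexlt_total by blast
  qed
  then show ?thesis
    using assms by (auto simp: tlt_iff)
qed

lemma finite_tlt: "v \<in> idx m n \<Longrightarrow> finite {w \<in> idx m n. tlt m w v}"
  by (rule finite_subset[OF _ finite_sz_le[of m n "sz m v"]]) (auto simp: tlt_iff)

lemma tlt_rk: 
  assumes "v \<in> idx m n" "w \<in> idx m n"
  shows "rk m n v < rk m n w \<longleftrightarrow> tlt m v w"
proof -
  have less: "rk m n v < rk m n w" if "v \<in> idx m n" "w \<in> idx m n" "tlt m v w" for v w
    unfolding rk_def
  proof (rule psubset_card_mono[OF finite_tlt[OF that(2)]])
    have "v \<notin> {u \<in> idx m n. tlt m u v}" by (simp add: tlt_def)
    then show "{u \<in> idx m n. tlt m u v} \<subset> {u \<in> idx m n. tlt m u w}"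
      using that tlt_trans by blast
  qed
  then show ?thesis
    using assms tlt_total[OF assms] less[of w v] by fastforce
qed

lemma inj_rk: "inj_on (rk m n) (idx m n)"
  by (rule inj_onI) (metis tlt_total tlt_rk less_irrefl)

lemma varslt_rk: "(\<sigma>, k) \<in> idx m n \<Longrightarrow> varslt m n \<sigma> k = {w \<in> idx m n. rk m n w < rk m n (\<sigma>, k)}"
  by (auto simp: varslt_def idx_def tlt_rk[unfolded idx_def])

lemma sz_less_rk: "v \<in> idx m n \<Longrightarrow> w \<in> idx m n \<Longrightarrow> sz m v < sz m w \<Longrightarrow> rk m n v < rk m n w"
  by (simp add: tlt_rk tlt_iff)

lemma rk_less_sz: "v \<in> idx m n \<Longrightarrow> w \<in> idx m n \<Longrightarrow> rk m n v < rk m n w \<Longrightarrow> sz m v \<le> sz m w"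
  by (auto simp: tlt_rk tlt_iff)

lemma rk_shift:
  assumes "i < m" "v \<in> idx m n" shows "rk m n v < rk m n (shift i v)"
  using assms by (intro sz_less_rk shift_idx) (auto simp: sz_shift)

text \<open>A shift raises both sizes by one and both entries at \<open>i\<close> by one, so every
  comparison keeps its outcome. Inductions on rank rest on this: derivatives of earlier elements
  stay earlier.\<close>

lemma rk_shift_mono:
  assumes i: "i < m" and v: "v \<in> idx m n" and w: "w \<in> idx m n" and "rk m n v < rk m n w"
  shows "rk m n (shift i v) < rk m n (shift i w)"
proof -
  have "lexlt (m - 1) (fst (shift i v)) (fst (shift i w))" if "lexlt (m - 1) (fst v) (fst w)"
    using that by (auto simp: lexlt_def shift_def madd_def)
  then have "tlt m (shift i v) (shift i w)"
    using assms by (auto simp: tlt_rk tlt_iff shift_idx sz_shift) (auto simp: shift_def)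
  then show ?thesis
    using assms by (simp add: tlt_rk shift_idx)
qed

text \<open>All weight on coordinate 0, together with the last \<open>k\<close>, is the greatest
  index of size \<open>N\<close>. The initial segment there contains all smaller sizes too, so one
  instance of the differential condition covers them at once.\<close>

lemma varsle_top:
  assumes "n > 0" "\<sigma> = (\<lambda>j. if j = 0 then N else 0)"
  shows "varsle m n \<sigma> (n - 1) = {v \<in> idx m n. sz m v \<le> N}" "\<sigma> \<in> NN m" "msize m \<sigma> = N"
proof -
  show NN: "\<sigma> \<in> NN m" using m assms by (auto simp: NN_def)
  show sz: "msize m \<sigma> = N"
    using m assms by (simp add: msize_def)
  have lex: "lexle (m - 1) \<xi> \<sigma>" if "\<xi> \<in> NN m" "msize m \<xi> = N" for \<xi>
  proof (cases "\<xi> 0 = N")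
    case True
    have "msize m \<xi> = \<xi> 0 + sum \<xi> ({..<m} - {0})"
      using m by (simp add: msize_def sum.remove)
    then have "sum \<xi> ({..<m} - {0}) = 0" using True that by simp
    then have "\<forall>i\<in>{..<m} - {0}. \<xi> i = 0" by simp
    then show ?thesis using True assms(2) unfolding lexle_def by auto
  next
    case False
    have "\<xi> 0 \<le> N" using that(2) m member_le_sum[of 0 "{..<m}" \<xi>] by (simp add: msize_def)
    with False have *: "\<xi> 0 < \<sigma> 0" using assms(2) by simp
    show ?thesis
    proof (cases "m = 1")
      case True then show ?thesis by (simp add: lexle_def)
    next
      case False
      then have "0 < m - 1" using m by simp
      then show ?thesis unfolding lexle_def using * by blast
    qed
  qed
  show "varsle m n \<sigma> (n - 1) = {v \<in> idx m n. sz m v \<le> N}"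
    using lex sz \<open>n > 0\<close> by (force simp: varsle_def idx_def sz_def tle_def)
qed

end

section \<open>Leaders\<close>

lemma sep_algebraic_mem:
  assumes "is_subfield_set F" "x \<in> F" shows "sep_algebraic F x"
proof -
  have "poly_over F [:- x, 1:]" "poly_over F 0" "poly_over F 1"
    using subfield_setD[OF assms(1)] assms(2)
    by (auto simp: poly_over_def coeff_pCons split: nat.splits)
  moreover have "0 * [:- x, 1:] + 1 * pderiv [:- x, 1:] = 1"
    by (simp add: pderiv_pCons)
  moreover have "poly [:- x, 1:] x = 0" by simp
  ultimately show ?thesis unfolding sep_algebraic_def by blast
qed

section \<open>The given extension and the derivations on its lower part\<close>

locale partial_extension =
  fixes K :: "'a::field set" and m :: nat and d :: "nat \<Rightarrow> 'a \<Rightarrow> 'a" and n r :: nat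
    and a :: "nat \<Rightarrow> (nat \<Rightarrow> nat) \<Rightarrow> 'a"
  assumes m: "m > 0" and n: "n > 0" and r: "r > 0"
    and diff_field: "diff_field K m d"
    and diff_cond: "differential_condition K m d n r a"
    and leaders: "\<forall>k<n. (\<forall>\<sigma>. min_sep_leader K m n r a k \<sigma> \<longrightarrow> msize m \<sigma> \<le> r) \<or>
               (\<exists>\<tau>\<in>NN m. msize m \<tau> = 2 * r \<and>
                  (\<forall>\<sigma>. min_sep_leader K m n r a k \<sigma> \<longrightarrow> mle m \<sigma> \<tau>))"
begin

abbreviation "I \<equiv> idx m n"
abbreviation "R \<equiv> rk m n"

definition gen :: "index \<Rightarrow> 'a" where "gen v = a (snd v) (fst v)"

definition L :: "'a set" where "L = gen_field (K \<union> gen ` {v \<in> I. sz m v < 2 * r})"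

definition T :: "index set" where "T = {v \<in> I. sz m v = 2 * r}"

definition below :: "index \<Rightarrow> 'a set" where
  "below v = gen_field (K \<union> gen ` {w \<in> I. R w < R v})"

lemma K: "is_subfield_set K" and d: "i < m \<Longrightarrow> der_on id K (d i)"
  and d_K: "i < m \<Longrightarrow> c \<in> K \<Longrightarrow> d i c \<in> K"
  and d_comm: "i < m \<Longrightarrow> j < m \<Longrightarrow> c \<in> K \<Longrightarrow> d i (d j c) = d j (d i c)"
  using diff_field unfolding diff_field_def derivation_on_def der_on_def id_apply by blast+

lemma L: "is_subfield_set L"
  unfolding L_def by (rule is_subfield_set_gen_field)

lemma K_L: "c \<in> K \<Longrightarrow> c \<in> L" and gen_L: "v \<in> I \<Longrightarrow> sz m v < 2 * r \<Longrightarrow> gen v \<in> L"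
  unfolding L_def by (auto intro: gen_field_base)

lemma finite_T: "finite T"
  unfolding T_def by (rule finite_subset[OF _ finite_sz_le[of m n "2 * r"]]) auto

lemma ex_delta:
  assumes i: "i < m"
  shows "\<exists>D. der_on id L D \<and> (\<forall>c\<in>K. D c = d i c) \<and>
    (\<forall>v\<in>I. sz m v < 2 * r \<longrightarrow> D (gen v) = gen (shift i v))"
proof -
  interpret field_hom "id :: 'a \<Rightarrow> 'a" by (rule field_hom_id)
  define V where "V = {v \<in> I. sz m v \<le> 2 * r - 1}"
  \<comment> \<open>The greatest index of order \<open>2 * r - 1\<close>, the last order at which
    the differential condition is available.\<close>
  define \<sigma> where "\<sigma> = (\<lambda>j::nat. if j = 0 then 2 * r - 1 else 0)"
  have fin: "finite V" unfolding V_def by (rule finite_sz_le)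
  note top = varsle_top[OF m n, of \<sigma> "2 * r - 1", folded V_def, OF \<sigma>_def]
  have gen': "(\<lambda>(\<xi>, h). a h \<xi>) = gen"
    by (auto simp: gen_def)
  have d0: "d i 0 = 0" by (rule der_zero[OF K d[OF i]])
  have "pder (d i) f gen (\<lambda>v. gen (shift i v)) = 0"
    if f: "is_poly_over K V f" "peval f gen = 0" for f
  proof -
    have *: "msize m \<sigma> + 1 \<le> 2 * r" "n - 1 < n" using top n r by auto
    have "(\<Sum>(\<eta>, g)\<in>V. ppartial_eval f (\<eta>, g) gen * a g (madd \<eta> (eps i))) + peval (pcoeffmap (d i) f) gen = 0"
      using diff_cond i *(2) top(2) *(1) f unfolding differential_condition_def gen' top(1)[symmetric]
      by blast
    moreover have "(\<Sum>(\<eta>, g)\<in>V. ppartial_eval f (\<eta>, g) gen * a g (madd \<eta> (eps i)))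
      = (\<Sum>v\<in>V. ppartial_eval f v gen * gen (shift i v))"
      by (intro sum.cong) (auto simp: gen_def shift_def)
    ultimately show ?thesis
      using pder_eq_partials[where d = "d i" and A = gen and B = "\<lambda>v. gen (shift i v)", OF fin f(1)] d0
      by simp
  qed
  from extend_derivation[OF K d[OF i] this] obtain D where
    "der_on id (gen_field (K \<union> gen ` V)) D" "\<And>c. c \<in> K \<Longrightarrow> D c = d i c"
    "\<And>v. v \<in> V \<Longrightarrow> D (gen v) = gen (shift i v)" by metis
  moreover have "V = {v \<in> I. sz m v < 2 * r}"
    unfolding V_def using r by auto
  ultimately show ?thesis unfolding L_def by auto
qed

definition \<delta> :: "nat \<Rightarrow> 'a \<Rightarrow> 'a" where
  "\<delta> i = (SOME D. der_on id L D \<and> (\<forall>c\<in>K. D c = d i c) \<and>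
    (\<forall>v\<in>I. sz m v < 2 * r \<longrightarrow> D (gen v) = gen (shift i v)))"

lemma
  assumes "i < m"
  shows \<delta>: "der_on id L (\<delta> i)" and \<delta>_K: "\<And>c. c \<in> K \<Longrightarrow> \<delta> i c = d i c"
    and \<delta>_gen: "\<And>v. v \<in> I \<Longrightarrow> sz m v < 2 * r \<Longrightarrow> \<delta> i (gen v) = gen (shift i v)"
  using someI_ex[OF ex_delta[OF assms], folded \<delta>_def] by auto

lemma below_L: 
  assumes "v \<in> I" "sz m v < 2 * r" shows "below v \<subseteq> L"
  unfolding below_def L_def using assms rk_less_sz[OF m]
  by (intro gen_field_mono) fastforce

text \<open>A generator is sent to its shift, which lies in \<open>L\<close> or, when the order
  becomes \<open>2 * r\<close>, in \<open>T\<close>; the product and quotient rules then keep the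
  values in the span. So derivatives involve the generators of order \<open>2 * r\<close> only
  linearly.\<close>

lemma \<delta>_lspan:
  assumes "i < m" "x \<in> L" shows "\<delta> i x \<in> lspan L gen T"
proof -
  interpret field_hom "id :: 'a \<Rightarrow> 'a" by (rule field_hom_id)
  note der = der_gen_field[of "K \<union> gen ` {v \<in> I. sz m v < 2 * r}", folded L_def]
  show ?thesis
  proof (rule der[OF \<delta>[OF assms(1)] _ _ _ _ assms(2)])
    fix y assume "y \<in> K \<union> gen ` {v \<in> I. sz m v < 2 * r}"
    then consider "y \<in> K" | v where "v \<in> I" "sz m v < 2 * r" "y = gen v" by auto
    then show "\<delta> i y \<in> lspan L gen T"
    proof cases
      case 1
      then show ?thesis using assms d_K K_L by (auto simp: \<delta>_K intro!: lspan_base[OF L])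
    next
      case 2
      show ?thesis
      proof (cases "sz m (shift i v) < 2 * r")
        case True
        then show ?thesis using 2 assms gen_L[OF shift_idx[OF assms(1) 2(1)] True] by (auto simp: \<delta>_gen intro!: lspan_base[OF L])
      next
        case False
        then have "shift i v \<in> T" using 2 assms by (auto simp: T_def shift_idx sz_shift)
        then show ?thesis using 2 assms by (auto simp: \<delta>_gen intro!: lspan_gen[OF L finite_T])
      qed
    qed
  qed (auto intro: lspan_add[OF L] lspan_scale[OF L] lspan_base[OF L] subfield_setD[OF L])
qed

text \<open>A leader of order \<open>2r\<close> only counts if it satisfies a linear relation: algebraic relations
  among generators of order \<open>2r\<close> are not constrained by the differential condition, so these
  generators are replaced by new indeterminates as far as linear dependence permits.\<close>

definition low_leader :: "index \<Rightarrow> bool" where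
  "low_leader v \<longleftrightarrow> v \<in> I \<and> (sz m v < 2 * r \<and> sep_algebraic (below v) (gen v) \<or>
     sz m v = 2 * r \<and> gen v \<in> lspan L gen {w \<in> T. R w < R v})"

text \<open>Above order \<open>2 * r\<close> there are no generators to test, so the notion is
  continued by closing upwards. Up to that order nothing new arises, by
  \<open>leader_low\<close>.\<close>

definition leader :: "index \<Rightarrow> bool" where
  "leader v \<longleftrightarrow> v \<in> I \<and> (\<exists>u. low_leader u \<and> snd u = snd v \<and> mle m (fst u) (fst v))"

lemma sep_leader_iff:
  "sep_leader K m n r a k \<sigma> \<longleftrightarrow> (\<sigma>, k) \<in> I \<and> sz m (\<sigma>, k) \<le> 2 * r \<and>
     sep_algebraic (below (\<sigma>, k)) (gen (\<sigma>, k))"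
proof -
  have "K \<union> {a h \<xi> |\<xi> h. (\<xi>, h) \<in> varslt m n \<sigma> k} = K \<union> gen ` {w \<in> I. R w < R (\<sigma>, k)}"
    if "(\<sigma>, k) \<in> I"
    unfolding varslt_rk[OF m that] by (force simp: gen_def)
  then show ?thesis
    by (auto simp: sep_leader_def idx_def sz_def gen_def below_def)
qed

text \<open>Differentiating the separable equation of \<open>gen v\<close> expresses
  \<open>gen (shift i v)\<close> through derivatives of what lies below \<open>v\<close>. While the
  order stays under \<open>2 * r\<close> these generate a field of earlier elements; at order
  \<open>2 * r\<close> they enter linearly, which gives the required linear relation.\<close>

lemma low_leader_shift:
  assumes v: "low_leader v" "sz m v < 2 * r" and i: "i < m"
  shows "low_leader (shift i v)"
proof -
  interpret field_hom "id :: 'a \<Rightarrow> 'a" by (rule field_hom_id)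
  \<comment> \<open>\<open>gen v\<close> is included, because the coefficients in its derivative
    involve \<open>gen v\<close> itself.\<close>
  define E where "E = gen_field (K \<union> gen ` {w \<in> I. R w \<le> R v})"
  have vI: "v \<in> I" and sep: "sep_algebraic (below v) (gen v)"
    using v by (auto simp: low_leader_def)
  have sI: "shift i v \<in> I" using shift_idx i vI .
  have E: "is_subfield_set E" unfolding E_def by (rule is_subfield_set_gen_field)
  have szE: "sz m w < 2 * r" if "w \<in> I" "R w \<le> R v" for w
    using that v(2) rk_less_sz[OF m that(1) vI] inj_onD[OF inj_rk[OF m] _ that(1) vI]
    by (cases "R w = R v") auto
  have EL: "E \<subseteq> L" unfolding E_def L_def using szE by (intro gen_field_mono) auto
  have bE: "below v \<subseteq> E" unfolding E_def below_def by (intro gen_field_mono) auto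
  have gE: "gen v \<in> E" unfolding E_def using vI by (intro gen_field_base) auto
  \<comment> \<open>Both cases below follow from this with different \<open>W\<close>: the field
    \<open>below (shift i v)\<close>, or a span over \<open>L\<close>.\<close>
  have key: "gen (shift i v) \<in> W"
    if W: "\<And>u v. u \<in> W \<Longrightarrow> v \<in> W \<Longrightarrow> u + v \<in> W" "0 \<in> W"
      "\<And>c u. c \<in> E \<Longrightarrow> u \<in> W \<Longrightarrow> c * u \<in> W"
      and KW: "\<And>c. c \<in> K \<Longrightarrow> c \<in> W"
      and gW: "\<And>w. w \<in> I \<Longrightarrow> R w < R v \<Longrightarrow> gen (shift i w) \<in> W" for W
  proof -
    have "\<delta> i y \<in> W" if y: "y \<in> below v" for y
      using y unfolding below_def
    proof (rule der_gen_field[rotated -1])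
      show "der_on id (gen_field (K \<union> gen ` {w \<in> I. R w < R v})) (\<delta> i)"
        using bE EL unfolding below_def by (intro der_on_mono[OF \<delta>[OF i]]) auto
      show "id c * u \<in> W" if "c \<in> gen_field (K \<union> gen ` {w \<in> I. R w < R v})" "u \<in> W" for c u
        using W(3) that bE by (auto simp: below_def)
      show "\<delta> i y \<in> W" if "y \<in> K \<union> gen ` {w \<in> I. R w < R v}" for y
        using that i KW gW d_K szE by (auto simp: \<delta>_K \<delta>_gen)
    qed (use W in auto)
    then have "\<delta> i (gen v) \<in> W"
      using W by (intro der_sep_algebraic[OF E der_on_mono[OF \<delta>[OF i] EL] _ bE gE sep])
        (auto simp: below_def is_subfield_set_gen_field)
    then show ?thesis using \<delta>_gen[OF i vI v(2)] by simp
  qed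
  show ?thesis
  proof (cases "sz m (shift i v) < 2 * r")
    case True
    have sub: "E \<subseteq> below (shift i v)"
    proof -
      have "R w < R (shift i v)" if "R w \<le> R v" for w
        using that rk_shift[OF m i vI] by simp
      then show ?thesis unfolding E_def below_def by (intro gen_field_mono) auto
    qed
    have "gen (shift i v) \<in> below (shift i v)"
    proof (rule key)
      show "gen (shift i w) \<in> below (shift i v)" if "w \<in> I" "R w < R v" for w
        using that rk_shift_mono[OF m i that(1) vI] i
        unfolding below_def by (intro gen_field_base) (auto simp: shift_idx)
    qed (use sub in \<open>auto simp: below_def intro: gen_fieldI gen_field_base\<close>)
    then show ?thesis
      using sI True by (auto simp: low_leader_def below_def intro: sep_algebraic_mem is_subfield_set_gen_field)
  next
    case False
    then have s: "sz m (shift i v) = 2 * r" using v(2) i by (simp add: sz_shift)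
    let ?W = "lspan L gen {w \<in> T. R w < R (shift i v)}"
    have fin: "finite {w \<in> T. R w < R (shift i v)}" using finite_T by simp
    have "gen (shift i v) \<in> ?W"
    proof (rule key)
      fix w assume w: "w \<in> I" "R w < R v"
      have lt: "R (shift i w) < R (shift i v)" using rk_shift_mono[OF m i w(1) vI w(2)] .
      show "gen (shift i w) \<in> ?W"
      proof (cases "sz m (shift i w) < 2 * r")
        case True
        then show ?thesis using w i by (intro lspan_base[OF L] gen_L shift_idx)
      next
        case False
        then have "sz m (shift i w) = 2 * r"
          using szE[of w] w i by (simp add: sz_shift)
        then show ?thesis using lt w i by (intro lspan_gen[OF L fin]) (auto simp: T_def shift_idx)
      qed
    qed (use EL K_L in \<open>auto intro: lspan_add[OF L] lspan_scale[OF L] lspan_base[OF L] subfield_setD[OF L]\<close>)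
    then show ?thesis using sI s by (auto simp: low_leader_def)
  qed
qed

section \<open>Closure properties of leaders, and minimal leaders\<close>

lemma shift_pred:
  assumes "v \<in> I" "i < m" "fst v i > 0"
  obtains u where "u \<in> I" "shift i u = v" "fst u = (fst v)(i := fst v i - 1)" "snd u = snd v"
proof (rule that)
  let ?u = "((fst v)(i := fst v i - 1), snd v)"
  show "?u \<in> I" using assms by (auto simp: idx_def NN_def)
  show "shift i ?u = v" using assms by (auto simp: shift_def madd_def eps_def prod_eq_iff)
qed auto

lemma mle_diff:
  assumes "u \<in> I" "v \<in> I" "snd u = snd v" "mle m (fst u) (fst v)" "u \<noteq> v"
  obtains i where "i < m" "fst u i < fst v i"
proof -
  obtain i where i: "fst u i \<noteq> fst v i"
    using assms(3,5) by (metis ext prod_eqI)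
  have "fst u i = 0" "fst v i = 0" if "\<not> i < m"
    using assms(1,2) that by (auto simp: idx_def NN_def)
  then have "i < m" using i by fastforce
  moreover have "fst u i \<le> fst v i" using assms(4) \<open>i < m\<close> by (simp add: mle_def)
  ultimately show ?thesis using that i by simp
qed

text \<open>Climb from the low leader \<open>u\<close> to \<open>v\<close> by single shifts; every
  index before the last has order below \<open>2 * r\<close>, as \<open>low_leader_shift\<close>
  requires.\<close>

lemma leader_low:
  assumes "leader v" "sz m v \<le> 2 * r" shows "low_leader v"
proof -
  obtain u where u: "low_leader u" "snd u = snd v" "mle m (fst u) (fst v)" and "v \<in> I"
    using assms(1) by (auto simp: leader_def)
  have uI: "u \<in> I" using u by (simp add: low_leader_def)
  from u(2,3) \<open>v \<in> I\<close> assms(2) show ?thesis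
  proof (induction "sz m v" arbitrary: v rule: less_induct)
    case less
    show ?case
    proof (cases "u = v")
      case True
      then show ?thesis using u by simp
    next
      case False
      then obtain i where i: "i < m" "fst u i < fst v i"
        using mle_diff[OF uI less(4) less(2,3)] by blast
      then obtain w where w: "w \<in> I" "shift i w = v" "fst w = (fst v)(i := fst v i - 1)" "snd w = snd v"
        using shift_pred[OF less(4) i(1)] by auto
      have s: "sz m v = Suc (sz m w)" using w(2) i(1) sz_shift by blast
      have "mle m (fst u) (fst w)" using less(3) i w(3) by (auto simp: mle_def)
      then have "low_leader w" using less s w by auto
      then show ?thesis using low_leader_shift[OF \<open>low_leader w\<close> _ i(1)] w(2) s less(5) by auto
    qed
  qed
qed

lemma leader_idx: "leader v \<Longrightarrow> v \<in> I"
  by (simp add: leader_def)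

lemma leader_mono:
  assumes "leader u" "v \<in> I" "snd u = snd v" "mle m (fst u) (fst v)"
  shows "leader v"
proof -
  obtain w where "low_leader w" "snd w = snd u" "mle m (fst w) (fst u)"
    using assms(1) by (auto simp: leader_def)
  moreover have "mle m (fst w) (fst v)"
    using calculation(3) assms(4) unfolding mle_def by (meson order_trans)
  ultimately show ?thesis using assms(2,3) by (auto simp only: leader_def)
qed

lemma leader_shift: "leader v \<Longrightarrow> i < m \<Longrightarrow> leader (shift i v)"
  by (rule leader_mono[of v]) (auto simp: leader_idx shift_idx, auto simp: shift_def mle_def madd_def)

text \<open>A low leader beneath \<open>v\<close> has order at most \<open>2 * r\<close>, so
  \<open>v\<close> exceeds it in some coordinate, and stepping back there stays above it.\<close>

lemma leader_pred:
  assumes "leader v" "sz m v > 2 * r"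
  obtains i u where "i < m" "leader u" "shift i u = v"
proof -
  obtain w where w: "low_leader w" "snd w = snd v" "mle m (fst w) (fst v)" and v: "v \<in> I"
    using assms(1) by (auto simp: leader_def)
  have wI: "w \<in> I" and "sz m w \<le> 2 * r" using w by (auto simp: low_leader_def)
  then have "w \<noteq> v" using assms(2) by auto
  then obtain i where i: "i < m" "fst w i < fst v i"
    using mle_diff[OF wI v w(2,3)] by blast
  then obtain u where u: "u \<in> I" "shift i u = v" "fst u = (fst v)(i := fst v i - 1)" "snd u = snd v"
    using shift_pred[OF v i(1)] by auto
  have "leader u" unfolding leader_def using w u i by (intro conjI exI[of _ w]) (auto simp: mle_def)
  then show ?thesis using that i u by blast
qed

text \<open>Take a low leader of least size beneath \<open>v\<close>. It is a separable leader: at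
  order \<open>2 * r\<close>, a linear relation puts its generator into the field
  \<open>below\<close>. A separable leader strictly beneath it would have order less than
  \<open>2 * r\<close>, hence be a smaller low leader.\<close>

lemma leader_minimal:
  assumes "leader v"
  obtains \<mu> where "min_sep_leader K m n r a (snd v) \<mu>" "leader (\<mu>, snd v)" "mle m \<mu> (fst v)"
proof -
  let ?P = "\<lambda>\<mu>. low_leader (\<mu>, snd v) \<and> mle m \<mu> (fst v)"
  obtain u where "low_leader u" "snd u = snd v" "mle m (fst u) (fst v)"
    using assms by (auto simp: leader_def)
  then have "?P (fst u)" by (metis prod.collapse)
  then obtain \<mu> where \<mu>: "?P \<mu>" and least: "\<And>\<rho>. ?P \<rho> \<Longrightarrow> msize m \<mu> \<le> msize m \<rho>"
    using ex_has_least_nat[of ?P "fst u" "msize m"] by blast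
  have I: "(\<mu>, snd v) \<in> I" and s: "sz m (\<mu>, snd v) \<le> 2 * r" using \<mu> by (auto simp: low_leader_def)
  have "sep_algebraic (below (\<mu>, snd v)) (gen (\<mu>, snd v))"
  proof (cases "sz m (\<mu>, snd v) < 2 * r")
    case True
    then show ?thesis using \<mu> by (auto simp: low_leader_def)
  next
    case False
    let ?w = "(\<mu>, snd v)"
    have ls: "gen ?w \<in> lspan L gen {w \<in> T. R w < R ?w}" and sw: "sz m ?w = 2 * r"
      using \<mu> False s by (auto simp: low_leader_def)
    have "L \<subseteq> below ?w"
      unfolding L_def below_def using sz_less_rk[OF m _ I] sw by (intro gen_field_mono) auto
    moreover have "gen w \<in> below ?w" if "w \<in> T" "R w < R ?w" for w
      using that by (auto simp: below_def T_def intro!: gen_field_base)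
    moreover have bf: "is_subfield_set (below ?w)"
      by (simp add: below_def is_subfield_set_gen_field)
    ultimately have "gen ?w \<in> below ?w"
      using ls unfolding lspan_def
      by (fastforce intro!: subfield_setD[OF bf] subfield_set_sum[OF bf])
    then show ?thesis by (auto simp: below_def intro: sep_algebraic_mem is_subfield_set_gen_field)
  qed
  then have sl: "sep_leader K m n r a (snd v) \<mu>" using I s by (simp add: sep_leader_iff)
  have "min_sep_leader K m n r a (snd v) \<mu>"
    unfolding min_sep_leader_def
  proof (intro conjI ballI impI notI sl)
    fix \<rho> assume \<rho>: "\<rho> \<in> NN m" "mle m \<rho> \<mu> \<and> \<rho> \<noteq> \<mu>" and sl\<rho>: "sep_leader K m n r a (snd v) \<rho>"
    have \<rho>I: "(\<rho>, snd v) \<in> I" using sl\<rho> by (simp add: sep_leader_iff)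
    obtain i where "i < m" "\<rho> i < \<mu> i"
      using mle_diff[OF \<rho>I I] \<rho> by auto
    then have lt: "msize m \<rho> < msize m \<mu>"
      using \<rho> unfolding msize_def mle_def by (intro sum_strict_mono_ex1) auto
    then have "low_leader (\<rho>, snd v)"
      using sl\<rho> s by (auto simp: low_leader_def sep_leader_iff sz_def)
    moreover have "mle m \<rho> (fst v)" using \<rho> \<mu> unfolding mle_def by (meson order_trans)
    ultimately show False using least[of \<rho>] lt by simp
  qed
  moreover have "leader (\<mu>, snd v)"
    using \<mu> I by (auto simp: leader_def mle_def)
  ultimately show ?thesis using that \<mu> by blast
qed

text \<open>Otherwise \<open>\<sigma>\<close> lies under the join of the two minimal leaders. That
  join has size at most \<open>r + r\<close> in the first case of the hypothesis, and lies under
  \<open>\<tau>\<close> in the second.\<close>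

lemma min_leaders_join:
  assumes k: "k < n" and \<mu>: "min_sep_leader K m n r a k \<mu>" "min_sep_leader K m n r a k \<mu>'"
    and s: "msize m \<sigma> > 2 * r"
  obtains l where "l < m" "\<mu> l < \<sigma> l" "\<mu>' l < \<sigma> l"
proof (rule ccontr)
  assume "\<not> thesis"
  then have max: "\<sigma> l \<le> max (\<mu> l) (\<mu>' l)" if "l < m" for l
    using that \<open>\<And>l. l < m \<Longrightarrow> \<mu> l < \<sigma> l \<Longrightarrow> \<mu>' l < \<sigma> l \<Longrightarrow> thesis\<close> by (meson leI le_max_iff_disj)
  from leaders k consider "\<forall>\<sigma>. min_sep_leader K m n r a k \<sigma> \<longrightarrow> msize m \<sigma> \<le> r"
    | \<tau> where "msize m \<tau> = 2 * r" "\<forall>\<sigma>. min_sep_leader K m n r a k \<sigma> \<longrightarrow> mle m \<sigma> \<tau>" by blast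
  then show False
  proof cases
    case 1
    have "msize m \<sigma> \<le> (\<Sum>i<m. \<mu> i + \<mu>' i)"
      unfolding msize_def using max by (intro sum_mono) fastforce
    also have "\<dots> = msize m \<mu> + msize m \<mu>'" by (simp add: msize_def sum.distrib)
    also have "\<dots> \<le> 2 * r" using 1 \<mu> by (metis add_mono mult_2)
    finally show False using s by simp
  next
    case 2
    have "msize m \<sigma> \<le> msize m \<tau>"
      unfolding msize_def
    proof (rule sum_mono)
      fix i assume "i \<in> {..<m}"
      then have "\<mu> i \<le> \<tau> i" "\<mu>' i \<le> \<tau> i" "\<sigma> i \<le> max (\<mu> i) (\<mu>' i)"
        using max 2 \<mu> by (auto simp: mle_def)
      then show "\<sigma> i \<le> \<tau> i" by linarith
    qed
    then show False using s 2 by simp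
  qed
qed

text \<open>The third leader lies one step below \<open>v\<close> in a direction where \<open>v\<close> exceeds both minimal
  leaders; this is the only use of the hypothesis on minimal leaders.\<close>

lemma leader_bridge:
  assumes v: "sz m v > 2 * r" and i: "i < m" "leader u" "shift i u = v"
    and j: "j < m" "leader u'" "shift j u' = v"
  obtains l w where "l < m" "shift l w = v"
    "(i = l \<and> u = w) \<or> (\<exists>\<pi>. leader \<pi> \<and> u = shift l \<pi> \<and> w = shift i \<pi>)"
    "(j = l \<and> u' = w) \<or> (\<exists>\<pi>. leader \<pi> \<and> u' = shift l \<pi> \<and> w = shift j \<pi>)"
proof -
  have vI: "v \<in> I" using i leader_shift leader_idx by blast
  have snd: "snd u = snd v" "snd u' = snd v" using i(3) j(3) by (auto simp: shift_def)
  obtain \<mu> where \<mu>: "min_sep_leader K m n r a (snd v) \<mu>" "leader (\<mu>, snd v)" "mle m \<mu> (fst u)"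
    using leader_minimal[OF i(2)] snd by metis
  obtain \<mu>' where \<mu>': "min_sep_leader K m n r a (snd v) \<mu>'" "leader (\<mu>', snd v)" "mle m \<mu>' (fst u')"
    using leader_minimal[OF j(2)] snd by metis
  obtain l where l: "l < m" "\<mu> l < fst v l" "\<mu>' l < fst v l"
    using min_leaders_join[OF _ \<mu>(1) \<mu>'(1), of "fst v"] vI v unfolding idx_def sz_def by (metis mem_Times_iff lessThan_iff)
  obtain w where w: "w \<in> I" "shift l w = v"
    using shift_pred[OF vI l(1)] l by (metis gr_implies_not_zero neq0_conv)
  \<comment> \<open>For \<open>i\<close> different from \<open>l\<close>, \<open>\<pi>\<close> is
    \<open>v\<close> stepped back in both directions. It is still above \<open>\<mu>\<close>,
    because \<open>u\<close> has the same entry at \<open>l\<close> as \<open>v\<close>, and this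
    exceeds that of \<open>\<mu>\<close>.\<close>
  have *: "(i = l \<and> u = w) \<or> (\<exists>\<pi>. leader \<pi> \<and> u = shift l \<pi> \<and> w = shift i \<pi>)"
    if i: "i < m" "leader u" "shift i u = v" and "snd u = snd v"
      and \<mu>: "leader (\<mu>, snd v)" "mle m \<mu> (fst u)" "\<mu> l < fst v l" for i u \<mu>
  proof (cases "i = l")
    case True
    then show ?thesis using i w shift_inj by metis
  next
    case False
    then have ul: "fst u l = fst v l" using i(3) by (auto simp: shift_def madd_def eps_def)
    obtain \<pi> where \<pi>: "\<pi> \<in> I" "shift l \<pi> = u" "fst \<pi> = (fst u)(l := fst u l - 1)" "snd \<pi> = snd u"
      using shift_pred[OF leader_idx[OF i(2)] l(1)] ul \<mu>(3) by (metis gr_implies_not_zero neq0_conv)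
    have "leader \<pi>"
    proof (rule leader_mono[OF \<mu>(1)])
      show "mle m (fst (\<mu>, snd v)) (fst \<pi>)" using \<mu> \<pi>(3) ul by (auto simp: mle_def)
    qed (use \<pi> that in auto)
    moreover have "shift l w = shift l (shift i \<pi>)"
      using w(2) i(3) \<pi>(2) shift_commute by metis
    ultimately show ?thesis using \<pi>(2) shift_inj by metis
  qed
  show ?thesis
    using that[OF l(1) w(2)] *[OF i snd(1) \<mu>(2,3) l(2)] *[OF j snd(2) \<mu>'(2,3) l(3)] by blast
qed

end

section \<open>The extension field and its derivations\<close>

context partial_extension
begin

section \<open>The indeterminates, and a linear map into their field\<close>

abbreviation e :: "'a \<Rightarrow> 'a ratfun" where "e \<equiv> rf_const"

sublocale e: field_hom e by (rule field_hom_rf_const)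

definition code :: "index \<Rightarrow> nat" where
  "code v = to_nat (map (fst v) [0..<m], snd v)"

definition xv :: "index \<Rightarrow> 'a ratfun" where "xv v = rf_var (code v)"

lemma inj_code: "inj_on code I"
proof (rule inj_onI)
  fix v w assume vw: "v \<in> I" "w \<in> I" "code v = code w"
  then have eq: "map (fst v) [0..<m] = map (fst w) [0..<m]" "snd v = snd w"
    by (auto simp: code_def)
  have "fst v i = fst w i" for i
  proof (cases "i < m")
    case True
    then show ?thesis using eq(1) by auto
  next
    case False
    then show ?thesis using vw by (auto simp: idx_def NN_def)
  qed
  then show "v = w" using eq(2) by (simp add: prod_eq_iff fun_eq_iff)
qed

lemma xv_independent:
  assumes "is_poly_over (e ` L) V f" "V \<subseteq> I" "peval f xv = 0"
  shows "f p = 0"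
proof -
  have "is_poly_over (range e) V f" using assms(1) unfolding is_poly_over_def by blast
  moreover have "inj_on code V" using inj_code assms(2) by (rule inj_on_subset)
  moreover have "peval f (\<lambda>v. rf_var (code v)) = 0" using assms(3) by (simp add: xv_def[abs_def])
  ultimately show ?thesis by (rule rf_var_independent)
qed

definition A0 :: "index \<Rightarrow> 'a ratfun" where
  "A0 = (SOME A. (\<forall>v\<in>T. gen v \<notin> lspan L gen {w\<in>T. R w < R v} \<longrightarrow> A v = xv v) \<and>
    (\<forall>v\<in>T. gen v \<in> lspan L gen {w\<in>T. R w < R v} \<longrightarrow> A v \<in> lspan (e ` L) A {w\<in>T. R w < R v}) \<and>
    (\<forall>c0 c. c0 \<in> L \<longrightarrow> (\<forall>w. c w \<in> L) \<longrightarrow> c0 + (\<Sum>v\<in>T. c v * gen v) = 0 \<longrightarrow>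
       e c0 + (\<Sum>v\<in>T. e (c v) * A v) = 0))"

lemma T_I: "v \<in> T \<Longrightarrow> v \<in> I" and sz_T: "v \<in> T \<Longrightarrow> sz m v = 2 * r"
  by (simp_all add: T_def)

lemma inj_R_T: "inj_on R T"
  by (rule inj_on_subset[OF inj_rk[OF m]]) (auto simp: T_def)

lemma leader_T: "v \<in> T \<Longrightarrow> leader v \<longleftrightarrow> gen v \<in> lspan L gen {w\<in>T. R w < R v}"
proof
  assume v: "v \<in> T"
  show "gen v \<in> lspan L gen {w\<in>T. R w < R v}" if "leader v"
    using leader_low[OF that] v by (simp add: T_def low_leader_def)
  show "leader v" if "gen v \<in> lspan L gen {w\<in>T. R w < R v}"
    using that v unfolding leader_def low_leader_def
    by (intro conjI exI[of _ v]) (auto simp: T_I sz_T mle_def)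
qed

lemma A0:
  shows A0_free: "v \<in> T \<Longrightarrow> \<not> leader v \<Longrightarrow> A0 v = xv v"
    and A0_leader: "v \<in> T \<Longrightarrow> leader v \<Longrightarrow> A0 v \<in> lspan (e ` L) A0 {w\<in>T. R w < R v}"
    and A0_relation: "c0 \<in> L \<Longrightarrow> (\<And>w. c w \<in> L) \<Longrightarrow> c0 + (\<Sum>v\<in>T. c v * gen v) = 0 \<Longrightarrow>
       e c0 + (\<Sum>v\<in>T. e (c v) * A0 v) = 0"
proof -
  note A0 = someI_ex[OF linear_lift[OF field_hom_rf_const L finite_T inj_R_T, of gen xv], folded A0_def]
  show "v \<in> T \<Longrightarrow> \<not> leader v \<Longrightarrow> A0 v = xv v"
    "v \<in> T \<Longrightarrow> leader v \<Longrightarrow> A0 v \<in> lspan (e ` L) A0 {w\<in>T. R w < R v}"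
    using A0 leader_T by blast+
  show "c0 \<in> L \<Longrightarrow> (\<And>w. c w \<in> L) \<Longrightarrow> c0 + (\<Sum>v\<in>T. c v * gen v) = 0 \<Longrightarrow>
       e c0 + (\<Sum>v\<in>T. e (c v) * A0 v) = 0"
    using A0 by blast
qed

text \<open>The \<open>L\<close>-linear map on the span of \<open>1\<close> and the generators of
  order \<open>2 * r\<close> that extends \<open>e\<close> and sends these generators to
  \<open>A0\<close>. It is no ring homomorphism, but derivatives of elements of \<open>L\<close> are
  combined only linearly.\<close>

definition \<phi> :: "'a \<Rightarrow> 'a ratfun" where
  "\<phi> y = (THE z. \<exists>c0 c. c0 \<in> L \<and> (\<forall>w. c w \<in> L) \<and> y = c0 + (\<Sum>v\<in>T. c v * gen v) \<and>
     z = e c0 + (\<Sum>v\<in>T. e (c v) * A0 v))"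

text \<open>Two expressions of one element differ by a linear relation, which \<open>A0\<close>
  respects.\<close>

lemma \<phi>_eq:
  assumes "c0 \<in> L" "\<And>w. c w \<in> L"
  shows "\<phi> (c0 + (\<Sum>v\<in>T. c v * gen v)) = e c0 + (\<Sum>v\<in>T. e (c v) * A0 v)"
  unfolding \<phi>_def
proof (rule the_equality)
  show "\<exists>c0' c'. c0' \<in> L \<and> (\<forall>w. c' w \<in> L) \<and> c0 + (\<Sum>v\<in>T. c v * gen v) = c0' + (\<Sum>v\<in>T. c' v * gen v) \<and>
     e c0 + (\<Sum>v\<in>T. e (c v) * A0 v) = e c0' + (\<Sum>v\<in>T. e (c' v) * A0 v)"
    using assms by blast
  fix z assume "\<exists>c0' c'. c0' \<in> L \<and> (\<forall>w. c' w \<in> L) \<and> c0 + (\<Sum>v\<in>T. c v * gen v) = c0' + (\<Sum>v\<in>T. c' v * gen v) \<and>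
     z = e c0' + (\<Sum>v\<in>T. e (c' v) * A0 v)"
  then obtain c0' c' where c': "c0' \<in> L" "\<And>w. c' w \<in> L"
    "c0 + (\<Sum>v\<in>T. c v * gen v) = c0' + (\<Sum>v\<in>T. c' v * gen v)"
    "z = e c0' + (\<Sum>v\<in>T. e (c' v) * A0 v)" by blast
  have "e (c0' - c0) + (\<Sum>v\<in>T. e (c' v - c v) * A0 v) = 0"
  proof (rule A0_relation)
    show "c0' - c0 + (\<Sum>v\<in>T. (c' v - c v) * gen v) = 0"
      using c'(3) by (simp add: algebra_simps sum_subtractf)
  qed (use assms c' subfield_setD[OF L] in auto)
  then show "z = e c0 + (\<Sum>v\<in>T. e (c v) * A0 v)"
    unfolding c'(4) by (simp add: e.hom_diff algebra_simps sum_subtractf)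
qed

lemma \<phi>_L: "c \<in> L \<Longrightarrow> \<phi> c = e c"
  using \<phi>_eq[of c "\<lambda>_. 0"] subfield_setD[OF L] by (simp add: e.hom_zero)

lemma \<phi>_gen:
  assumes "u \<in> T" shows "\<phi> (gen u) = A0 u"
proof -
  have "(\<Sum>v\<in>T. (if v = u then 1 else 0) * gen v) = (\<Sum>v\<in>T. if v = u then gen v else 0)"
    "(\<Sum>v\<in>T. e (if v = u then 1 else 0) * A0 v) = (\<Sum>v\<in>T. if v = u then A0 v else 0)"
    by (intro sum.cong; simp add: e.hom_zero e.hom_one)+
  then show ?thesis
    using \<phi>_eq[of 0 "\<lambda>v. if v = u then 1 else 0"] assms finite_T subfield_setD[OF L]
    by (simp add: e.hom_zero)
qed

lemma \<phi>_combination: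
  assumes y: "y \<in> lspan L gen T" "y' \<in> lspan L gen T" and s: "s \<in> L" "s' \<in> L"
  shows "\<phi> (s * y + s' * y') = e s * \<phi> y + e s' * \<phi> y'"
proof -
  obtain c0 c where c: "y = c0 + (\<Sum>v\<in>T. c v * gen v)" "c0 \<in> L" "\<And>w. c w \<in> L"
    using y(1) unfolding lspan_def by blast
  obtain b0 b where b: "y' = b0 + (\<Sum>v\<in>T. b v * gen v)" "b0 \<in> L" "\<And>w. b w \<in> L"
    using y(2) unfolding lspan_def by blast
  have "s * y + s' * y' = (s * c0 + s' * b0) + (\<Sum>v\<in>T. (s * c v + s' * b v) * gen v)"
    unfolding c(1) b(1) by (simp add: algebra_simps sum.distrib sum_distrib_left)
  also have "\<phi> \<dots> = e (s * c0 + s' * b0) + (\<Sum>v\<in>T. e (s * c v + s' * b v) * A0 v)"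
    using c b s subfield_setD[OF L] by (intro \<phi>_eq) auto
  also have "\<dots> = e s * \<phi> y + e s' * \<phi> y'"
    unfolding c(1) b(1) \<phi>_eq[OF c(2,3)] \<phi>_eq[OF b(2,3)]
    by (simp add: e.hom_add e.hom_mult algebra_simps sum.distrib sum_distrib_left)
  finally show ?thesis .
qed

lemma \<phi>_in:
  assumes "is_subfield_set F" "e ` L \<subseteq> F" "\<And>w. w \<in> T \<Longrightarrow> A0 w \<in> F" "y \<in> lspan L gen T"
  shows "\<phi> y \<in> F"
proof -
  obtain c0 c where c: "y = c0 + (\<Sum>v\<in>T. c v * gen v)" "c0 \<in> L" "\<And>w. c w \<in> L"
    using assms(4) unfolding lspan_def by blast
  show ?thesis
    unfolding c(1) \<phi>_eq[OF c(2,3)] using assms(2,3) c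
    by (intro subfield_setD[OF assms(1)] subfield_set_sum[OF assms(1)]) auto
qed

definition D0 :: "nat \<Rightarrow> 'a ratfun \<Rightarrow> 'a ratfun" where
  "D0 i y = \<phi> (\<delta> i (the_inv e y))"

lemma D0_e: "D0 i (e x) = \<phi> (\<delta> i x)"
  by (simp add: D0_def the_inv_f_f[OF e.hom_inj])

text \<open>The product rule is linear in the derivatives with coefficients from \<open>L\<close>,
  so it passes through \<open>\<phi>\<close>.\<close>

lemma D0:
  assumes i: "i < m" shows "der_on id (e ` L) (D0 i)"
  unfolding der_on_def
proof (intro ballI)
  interpret field_hom "id :: 'a \<Rightarrow> 'a" by (rule field_hom_id)
  fix x y assume "x \<in> e ` L" "y \<in> e ` L"
  then obtain x' y' where x: "x = e x'" "x' \<in> L" and y: "y = e y'" "y' \<in> L" by auto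
  note \<delta>L = \<delta>_lspan[OF i x(2)] \<delta>_lspan[OF i y(2)]
  have 1: "D0 i (x + y) = D0 i x + D0 i y"
    using \<phi>_combination[OF \<delta>L, of 1 1] subfield_setD[OF L]
    unfolding x y D0_e e.hom_add[symmetric] der_add[OF L \<delta>[OF i] x(2) y(2)] by (simp add: e.hom_one)
  have 2: "D0 i (x * y) = id x * D0 i y + D0 i x * id y"
    using \<phi>_combination[OF \<delta>L, of y' x'] x y
    unfolding x y D0_e e.hom_mult[symmetric] der_mult[OF L \<delta>[OF i] x(2) y(2)]
    by (simp add: mult.commute add.commute)
  show "D0 i (x + y) = D0 i x + D0 i y \<and> D0 i (x * y) = id x * D0 i y + D0 i x * id y"
    using 1 2 by blast
qed

section \<open>The field \<open>M\<close> and derivations with prescribed values on it\<close>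

definition N :: "index set" where "N = {v \<in> I. sz m v \<ge> 2 * r \<and> \<not> leader v}"

definition M :: "'a ratfun set" where "M = gen_field (e ` L \<union> xv ` N)"

text \<open>Only the indeterminates are filtered by rank; the image of \<open>L\<close> belongs to
  every level as a whole.\<close>

definition Mbelow :: "index \<Rightarrow> 'a ratfun set" where
  "Mbelow v = gen_field (e ` L \<union> xv ` {w \<in> N. R w < R v})"

lemmas der_L = e.der_gen_field[of "K \<union> gen ` {v \<in> I. sz m v < 2 * r}", folded L_def]

lemmas der_M = field_hom.der_gen_field[OF field_hom_id, of "e ` L \<union> xv ` N", folded M_def]

lemmas der_Mbelow =
  field_hom.der_gen_field[OF field_hom_id, of "e ` L \<union> xv ` {w \<in> N. R w < R v}", folded Mbelow_def] for v

lemma eL: "is_subfield_set (e ` L)"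
  by (rule e.subfield_set_image[OF L])

lemma M: "is_subfield_set M" and Mbelow: "is_subfield_set (Mbelow v)"
  unfolding M_def Mbelow_def by (rule is_subfield_set_gen_field)+

lemma e_Mbelow: "x \<in> L \<Longrightarrow> e x \<in> Mbelow v" and xv_Mbelow: "w \<in> N \<Longrightarrow> R w < R v \<Longrightarrow> xv w \<in> Mbelow v"
  unfolding Mbelow_def by (auto intro!: gen_field_base)

lemma e_M: "x \<in> L \<Longrightarrow> e x \<in> M" and xv_M: "w \<in> N \<Longrightarrow> xv w \<in> M"
  unfolding M_def by (auto intro!: gen_field_base)

lemma Mbelow_M: "Mbelow v \<subseteq> M"
  unfolding Mbelow_def M_def by (intro gen_field_mono) auto

lemma Mbelow_mono: "R v \<le> R w \<Longrightarrow> Mbelow v \<subseteq> Mbelow w"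
  unfolding Mbelow_def by (intro gen_field_mono) auto

text \<open>The family \<open>B\<close> is a parameter because the intended family \<open>A\<close>
  is itself built by recursion through these derivations.\<close>

definition Der :: "nat \<Rightarrow> (index \<Rightarrow> 'a ratfun) \<Rightarrow> 'a ratfun \<Rightarrow> 'a ratfun" where
  "Der i B = (SOME D. der_on id M D \<and> (\<forall>y\<in>e ` L. D y = D0 i y) \<and> (\<forall>v\<in>N. D (xv v) = B (shift i v)))"

text \<open>By algebraic independence only the zero polynomial vanishes at the indeterminates, so
  the condition of \<open>extend_derivation\<close> holds trivially and the values there can be
  prescribed at will.\<close>

lemma
  assumes i: "i < m"
  shows Der: "der_on id M (Der i B)" and Der_e: "x \<in> L \<Longrightarrow> Der i B (e x) = \<phi> (\<delta> i x)"
    and Der_xv: "v \<in> N \<Longrightarrow> Der i B (xv v) = B (shift i v)"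
proof -
  interpret field_hom "id :: 'a ratfun \<Rightarrow> 'a ratfun" by (rule field_hom_id)
  have d0: "D0 i 0 = 0" by (rule der_zero[OF eL D0[OF i]])
  have "pder (D0 i) f xv (\<lambda>v. B (shift i v)) = 0" if "is_poly_over (e ` L) N f" "peval f xv = 0" for f
  proof -
    have "psupp f = {}"
      using xv_independent[OF that(1) _ that(2)] by (auto simp: N_def psupp_def)
    then show ?thesis by (simp add: pder_def)
  qed
  from extend_derivation[OF eL D0[OF i] this] have
    "\<exists>D. der_on id M D \<and> (\<forall>y\<in>e ` L. D y = D0 i y) \<and> (\<forall>v\<in>N. D (xv v) = B (shift i v))"
    unfolding M_def by metis
  note D = someI_ex[OF this, folded Der_def]
  show "der_on id M (Der i B)" "x \<in> L \<Longrightarrow> Der i B (e x) = \<phi> (\<delta> i x)"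
    "v \<in> N \<Longrightarrow> Der i B (xv v) = B (shift i v)"
    using D D0_e by auto
qed

text \<open>Both derivations agree on the generators of \<open>Mbelow v\<close>. This allows a
  family known only up to some rank to stand in for the whole one.\<close>

lemma Der_local:
  assumes i: "i < m" and y: "y \<in> Mbelow v"
    and B: "\<And>w. w \<in> N \<Longrightarrow> R w < R v \<Longrightarrow> B (shift i w) = B' (shift i w)"
  shows "Der i B y = Der i B' y"
proof -
  have der: "der_on id (gen_field (e ` L \<union> xv ` {w \<in> N. R w < R v})) (Der i B)" for B
    using Mbelow_M unfolding Mbelow_def by (intro der_on_mono[OF Der[OF i]]) auto
  have "Der i B y = Der i B' y" if "y \<in> e ` L \<union> xv ` {w \<in> N. R w < R v}" for y
    using that i B by (auto simp: Der_e Der_xv)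
  from field_hom.der_gen_field_eq[OF field_hom_id der der this y[unfolded Mbelow_def]]
  show ?thesis .
qed

text \<open>Inside the recursion, \<open>f\<close> is cut off at the rank of \<open>v\<close>, so
  \<open>Der i f\<close> is built from incomplete data; \<open>A_leader\<close> replaces it by
  \<open>Der i A\<close>. The choice of \<open>i\<close> and \<open>u\<close> is arbitrary here and
  shown to be immaterial in \<open>D_A\<close>.\<close>

definition A :: "index \<Rightarrow> 'a ratfun" where
  "A = wfrec (measure R) (\<lambda>f v.
     if sz m v < 2 * r then e (gen v)
     else if sz m v = 2 * r then A0 v
     else if leader v then
       (let (i, u) = (SOME (i, u). i < m \<and> leader u \<and> shift i u = v) in Der i f (f u))
     else xv v)"

lemma A_gen: "sz m v < 2 * r \<Longrightarrow> A v = e (gen v)"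
  and A_T: "sz m v = 2 * r \<Longrightarrow> A v = A0 v"
  and A_high: "sz m v > 2 * r \<Longrightarrow> \<not> leader v \<Longrightarrow> A v = xv v"
  unfolding A_def by (subst wfrec; simp)+

lemma A_N: "v \<in> N \<Longrightarrow> A v = xv v"
  using A0_free[of v] A_high[of v] A_T[of v] by (cases "sz m v = 2 * r") (simp_all add: N_def T_def)

lemma A_rec:
  assumes "leader v" "sz m v > 2 * r"
  obtains i u where "i < m" "leader u" "shift i u = v" "A v = Der i (cut A (measure R) v) (A u)"
proof -
  let ?P = "\<lambda>(i, u). i < m \<and> leader u \<and> shift i u = v"
  obtain i u where iu: "(SOME p. ?P p) = (i, u)" by (cases "SOME p. ?P p")
  have "\<exists>p. ?P p" using leader_pred[OF assms] by blast
  from someI_ex[OF this] have P: "i < m" "leader u" "shift i u = v"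
    unfolding iu by auto
  have "R u < R v" using rk_shift[OF m P(1) leader_idx[OF P(2)]] P(3) by simp
  moreover have "A v = Der i (cut A (measure R) v) (cut A (measure R) v u)"
    using assms iu unfolding A_def by (subst wfrec) auto
  ultimately have "A v = Der i (cut A (measure R) v) (A u)"
    by (simp add: cut_apply)
  then show ?thesis using that P by blast
qed

text \<open>An indeterminate below \<open>u\<close> goes to the value at a shift below
  \<open>v\<close>, by monotonicity of shifts. Elements of \<open>L\<close> produce combinations of
  the \<open>A0 w\<close>, all of them earlier than \<open>v\<close> because its order exceeds
  \<open>2 * r\<close>.\<close>

lemma Der_Mbelow:
  assumes i: "i < m" and u: "u \<in> I" "2 * r < sz m v" "R (shift i u) \<le> R v" and y: "y \<in> Mbelow u"
    and A: "\<And>w. w \<in> I \<Longrightarrow> sz m w \<ge> 2 * r \<Longrightarrow> R w < R v \<Longrightarrow> A w \<in> Mbelow v" and v: "v \<in> I"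
  shows "Der i A y \<in> Mbelow v"
  using y
proof (rule der_Mbelow[rotated -1])
  have Ru: "R u < R v" using rk_shift[OF m i u(1)] u(3) by simp
  show "der_on id (Mbelow u) (Der i A)" by (rule der_on_mono[OF Der[OF i] Mbelow_M])
  show "id c * w \<in> Mbelow v" if "c \<in> Mbelow u" "w \<in> Mbelow v" for c w
    using that Mbelow_mono[of u v] Ru by (auto intro!: subfield_setD[OF Mbelow])
  fix y assume "y \<in> e ` L \<union> xv ` {w \<in> N. R w < R u}"
  then consider x where "x \<in> L" "y = e x" | w where "w \<in> N" "R w < R u" "y = xv w" by blast
  then show "Der i A y \<in> Mbelow v"
  proof cases
    case 1
    have "\<phi> (\<delta> i x) \<in> Mbelow v"
    proof (rule \<phi>_in[OF Mbelow _ _ \<delta>_lspan[OF i 1(1)]])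
      show "e ` L \<subseteq> Mbelow v" using e_Mbelow[of _ v] by auto
      show "A0 w \<in> Mbelow v" if "w \<in> T" for w
        using A[of w] sz_less_rk[OF m _ v, of w] u(2) that by (auto simp: T_def A_T)
    qed
    then show ?thesis using 1 i by (simp add: Der_e)
  next
    case 2
    then have wI: "w \<in> I" "sz m w \<ge> 2 * r" by (auto simp: N_def)
    have "R (shift i w) < R v" using rk_shift_mono[OF m i wI(1) u(1) 2(2)] u(3) by simp
    then have "A (shift i w) \<in> Mbelow v"
      using wI i by (intro A) (auto simp: shift_idx sz_shift)
    then show ?thesis using 2 i by (simp add: Der_xv)
  qed
qed (auto intro: subfield_setD[OF Mbelow])

text \<open>The two claims need a joint induction: \<open>A u\<close> in \<open>Mbelow u\<close> is
  what permits replacing the cut family by \<open>A\<close>, and the resulting equation puts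
  \<open>A v\<close> into \<open>Mbelow v\<close>.\<close>

lemma A_leader:
  assumes "leader v" "sz m v \<ge> 2 * r"
  shows "A v \<in> Mbelow v"
    and "sz m v > 2 * r \<Longrightarrow> \<exists>i u. i < m \<and> leader u \<and> shift i u = v \<and> A v = Der i A (A u)"
proof -
  have "A v \<in> Mbelow v \<and>
    (sz m v > 2 * r \<longrightarrow> (\<exists>i u. i < m \<and> leader u \<and> shift i u = v \<and> A v = Der i A (A u)))"
    using assms
  proof (induction "R v" arbitrary: v rule: less_induct)
    case less
    have vI: "v \<in> I" by (rule leader_idx[OF less(2)])
    have below: "A w \<in> Mbelow v" if w: "w \<in> I" "sz m w \<ge> 2 * r" "R w < R v" for w
    proof (cases "leader w")
      case True
      then show ?thesis using less(1)[OF w(3)] w Mbelow_mono[of w v] by auto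
    next
      case False
      then have "w \<in> N" using w by (simp add: N_def)
      then show ?thesis using xv_Mbelow w(3) by (simp add: A_N)
    qed
    show ?case
    proof (cases "sz m v = 2 * r")
      case True
      then have vT: "v \<in> T" using vI by (simp add: T_def)
      obtain c0 c where c: "A0 v = c0 + (\<Sum>w\<in>{w\<in>T. R w < R v}. c w * A0 w)" "c0 \<in> e ` L" "\<And>w. c w \<in> e ` L"
        using A0_leader[OF vT less(2)] unfolding lspan_def by blast
      have A0: "A0 w \<in> Mbelow v" if "w \<in> T" "R w < R v" for w
        using below[of w] that by (simp add: T_def A_T)
      have cM: "c w \<in> Mbelow v" for w using c(3)[of w] e_Mbelow[of _ v] by auto
      have "A0 v \<in> Mbelow v"
        unfolding c(1) using c(2) cM A0 e_Mbelow[of _ v]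
        by (intro subfield_setD[OF Mbelow] subfield_set_sum[OF Mbelow]) auto
      then show ?thesis using True by (simp add: A_T)
    next
      case False
      then have s: "sz m v > 2 * r" using less(3) by simp
      obtain i u where iu: "i < m" "leader u" "shift i u = v" "A v = Der i (cut A (measure R) v) (A u)"
        using A_rec[OF less(2) s] by blast
      have uI: "u \<in> I" by (rule leader_idx[OF iu(2)])
      have su: "sz m u \<ge> 2 * r" using s iu(1,3) sz_shift by fastforce
      have Ru: "R u < R v" using rk_shift[OF m iu(1) uI] iu(3) by simp
      have Au: "A u \<in> Mbelow u" using less(1)[OF Ru iu(2) su] by blast
      have Av: "A v = Der i A (A u)"
        unfolding iu(4)
      proof (rule Der_local[OF iu(1) Au])
        fix w assume w: "w \<in> N" "R w < R u"
        then have "R (shift i w) < R v"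
          using rk_shift_mono[OF m iu(1) _ uI, of w] iu(3) by (auto simp: N_def)
        then show "cut A (measure R) v (shift i w) = A (shift i w)" by (simp add: cut_apply)
      qed
      have "Der i A (A u) \<in> Mbelow v"
        using Der_Mbelow[OF iu(1) uI s _ Au below vI] iu(3) by simp
      then show ?thesis using Av iu(1-3) by metis
    qed
  qed
  then show "A v \<in> Mbelow v"
    "sz m v > 2 * r \<Longrightarrow> \<exists>i u. i < m \<and> leader u \<and> shift i u = v \<and> A v = Der i A (A u)"
    by blast+
qed

lemma A_M: "v \<in> I \<Longrightarrow> A v \<in> M"
  using A_leader(1)[of v] Mbelow_M[of v] A_N[of v] A_gen[of v] e_M[OF gen_L, of v] xv_M[of v]
  by (cases "sz m v < 2 * r"; cases "leader v") (auto simp: N_def)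

abbreviation "D i \<equiv> Der i A"

lemma D_M:
  assumes i: "i < m" and y: "y \<in> M" shows "D i y \<in> M"
  using y
proof (rule der_M[rotated -1])
  fix y assume "y \<in> e ` L \<union> xv ` N"
  then consider x where "x \<in> L" "y = e x" | w where "w \<in> N" "y = xv w" by blast
  then show "D i y \<in> M"
  proof cases
    case 1
    have "\<phi> (\<delta> i x) \<in> M"
      using A_M e_M by (intro \<phi>_in[OF M _ _ \<delta>_lspan[OF i 1(1)]]) (auto simp: T_def simp flip: A_T)
    then show ?thesis using 1 i by (simp add: Der_e)
  next
    case 2
    then show ?thesis using i A_M[OF shift_idx[OF i]] by (auto simp: Der_xv N_def)
  qed
qed (auto intro: subfield_setD[OF M] Der[OF i])

section \<open>Commutators, and independence of the choices\<close>

definition C :: "nat \<Rightarrow> nat \<Rightarrow> 'a ratfun \<Rightarrow> 'a ratfun" where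
  "C i l y = D i (D l y) - D l (D i y)"

lemma C:
  assumes "i < m" "l < m" shows "der_on id M (C i l)"
  unfolding der_on_def
proof (intro ballI conjI)
  interpret field_hom "id :: 'a ratfun \<Rightarrow> 'a ratfun" by (rule field_hom_id)
  note add = der_add[OF M Der[OF assms(1)]] der_add[OF M Der[OF assms(2)]]
  note mult = der_mult[OF M Der[OF assms(1)]] der_mult[OF M Der[OF assms(2)]]
  note DM = D_M[OF assms(1)] D_M[OF assms(2)]
  fix x y assume "x \<in> M" "y \<in> M"
  then show "C i l (x + y) = C i l x + C i l y" "C i l (x * y) = id x * C i l y + C i l x * id y"
    using subfield_setD[OF M] DM by (simp_all add: C_def add mult algebra_simps)
qed

lemma C_e:
  assumes "i < m" "l < m" shows "der_on e L (\<lambda>x. C i l (e x))"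
  using C[OF assms] e_M by (simp add: der_on_def e.hom_add e.hom_mult)

lemma D_e: "i < m \<Longrightarrow> c \<in> K \<Longrightarrow> D i (e c) = e (d i c)"
  using K_L d_K by (simp add: Der_e \<delta>_K \<phi>_L)

lemma C_K: "i < m \<Longrightarrow> l < m \<Longrightarrow> c \<in> K \<Longrightarrow> C i l (e c) = 0"
  using d_comm[of i l c] by (simp add: C_def D_e d_K)

lemma D_gen:
  assumes "i < m" "v \<in> I" "sz m v < 2 * r"
  shows "D i (e (gen v)) = A (shift i v)"
proof (cases "sz m (shift i v) < 2 * r")
  case True
  then show ?thesis using assms gen_L
    by (simp add: Der_e \<delta>_gen A_gen \<phi>_L shift_idx)
next
  case False
  then have "sz m (shift i v) = 2 * r" using assms by (simp add: sz_shift)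
  then show ?thesis using assms gen_L
    by (simp add: Der_e \<delta>_gen A_T \<phi>_gen T_def shift_idx)
qed

text \<open>The commutator of two derivations vanishes on \<open>A \<pi>\<close> once it vanishes on everything
  below \<open>\<pi>\<close>: a leader of order at least \<open>2r\<close> is a rational function of what lies below it,
  and one of order \<open>2r - 1\<close> is separably algebraic over it.\<close>

lemma C_leader:
  assumes i: "i < m" and l: "l < m" and \<pi>: "leader \<pi>" "2 * r \<le> Suc (sz m \<pi>)"
    and low: "\<And>w. w \<in> I \<Longrightarrow> R w < R \<pi> \<Longrightarrow> C i l (A w) = 0"
  shows "C i l (A \<pi>) = 0"
proof -
  have \<pi>I: "\<pi> \<in> I" by (rule leader_idx[OF \<pi>(1)])
  have Cb: "C i l (e x) \<in> {0}" if "x \<in> below v" "v \<in> I" "below v \<subseteq> L"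
    "\<And>w. w \<in> I \<Longrightarrow> R w < R v \<Longrightarrow> C i l (e (gen w)) = 0" for x v
    using that(1) unfolding below_def
  proof (rule e.der_gen_field[rotated -1])
    show "der_on e (gen_field (K \<union> gen ` {w \<in> I. R w < R v})) (\<lambda>x. C i l (e x))"
      using that(3) unfolding below_def by (rule der_on_mono[OF C_e[OF i l]])
    show "C i l (e y) \<in> {0}" if "y \<in> K \<union> gen ` {w \<in> I. R w < R v}" for y
      using that C_K[OF i l] \<open>\<And>w. w \<in> I \<Longrightarrow> R w < R v \<Longrightarrow> C i l (e (gen w)) = 0\<close> by auto
  qed auto
  show ?thesis
  proof (cases "sz m \<pi> < 2 * r")
    case True
    have sep: "sep_algebraic (below \<pi>) (gen \<pi>)"
      using leader_low[OF \<pi>(1)] True by (auto simp: low_leader_def)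
    have "sz m w < 2 * r" if "w \<in> I" "R w < R \<pi>" for w
      using rk_less_sz[OF m that(1) \<pi>I that(2)] True by simp
    then have 0: "C i l (e x) \<in> {0}" if "x \<in> below \<pi>" for x
      using that low by (intro Cb[OF _ \<pi>I below_L[OF \<pi>I True]]) (auto simp flip: A_gen)
    have "C i l (e (gen \<pi>)) \<in> {0}"
      by (rule e.der_sep_algebraic[OF L C_e[OF i l] _ below_L[OF \<pi>I True] gen_L[OF \<pi>I True] sep _ _ _ 0])
        (auto simp: below_def is_subfield_set_gen_field)
    then show ?thesis using True by (simp add: A_gen)
  next
    case False
    \<comment> \<open>All generators of \<open>L\<close> have smaller order than
      \<open>\<pi>\<close>, so the commutator vanishes on the whole image of
      \<open>L\<close>.\<close>
    have 0: "C i l (e (gen w)) = 0" if "w \<in> I" "sz m w < 2 * r" for w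
      using low[OF that(1)] sz_less_rk[OF m that(1) \<pi>I] that False by (simp add: A_gen)
    have eL0: "C i l (e x) \<in> {0}" if "x \<in> L" for x
      using that
    proof (rule der_L[rotated -1])
      show "C i l (e y) \<in> {0}" if "y \<in> K \<union> gen ` {v \<in> I. sz m v < 2 * r}" for y
        using that C_K[OF i l] 0 by auto
    qed (auto intro: C_e[OF i l])
    have "A \<pi> \<in> Mbelow \<pi>" using A_leader(1)[OF \<pi>(1)] False by simp
    then have "C i l (A \<pi>) \<in> {0}"
    proof (rule der_Mbelow[rotated -1])
      show "der_on id (Mbelow \<pi>) (C i l)" by (rule der_on_mono[OF C[OF i l] Mbelow_M])
      show "C i l y \<in> {0}" if "y \<in> e ` L \<union> xv ` {w \<in> N. R w < R \<pi>}" for y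
        using that
      proof
        assume "y \<in> xv ` {w \<in> N. R w < R \<pi>}"
        then obtain w where "w \<in> N" "R w < R \<pi>" "y = A w" using A_N by auto
        then show ?thesis using low[of w] by (simp add: N_def)
      qed (use eL0 in auto)
    qed auto
    then show ?thesis by simp
  qed
qed

text \<open>The induction is on the rank of the target \<open>shift i u\<close>. Generators and
  indeterminates obey the equation by construction; for a leader \<open>u\<close> of order at least
  \<open>2 * r\<close>, the choice made for \<open>A v\<close> is compared with \<open>i\<close> and
  \<open>u\<close> through \<open>leader_bridge\<close>.\<close>

lemma D_A:
  assumes "i < m" "u \<in> I" shows "D i (A u) = A (shift i u)"
proof -
  define v where "v = shift i u"
  have "v \<in> I" unfolding v_def using assms by (rule shift_idx)
  then show ?thesis using v_def assms
  proof (induction "R v" arbitrary: v u i rule: less_induct)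
    case less
    note v = less(2,3) and i = less(4) and u = less(5)
    have IH: "D j (A w) = A (shift j w)" if "j < m" "w \<in> I" "R (shift j w) < R v" for j w
      using less(1)[OF that(3) shift_idx[OF that(1,2)] refl that(1,2)] .
    consider "sz m u < 2 * r" | "u \<in> N" | "leader u" "sz m u \<ge> 2 * r"
      using u unfolding N_def by force
    then show ?case
    proof cases
      case 1
      then show ?thesis using D_gen i u by (simp add: A_gen)
    next
      case 2
      then show ?thesis using i by (simp add: A_N Der_xv)
    next
      case 3
      have s: "sz m v > 2 * r" using 3 i v by (simp add: sz_shift)
      have lv: "leader v" using leader_shift[OF 3(1) i] v by simp
      obtain j u' where j: "j < m" "leader u'" "shift j u' = v" "A v = D j (A u')"
        using A_leader(2)[OF lv] s by auto
      have swap: "D i (A (shift l \<pi>)) = D l (A (shift i \<pi>))"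
        if i: "i < m" and l: "l < m" and \<pi>: "leader \<pi>" "shift i (shift l \<pi>) = v" for i l \<pi>
      proof -
        have \<pi>I: "\<pi> \<in> I" by (rule leader_idx[OF \<pi>(1)])
        have "C i l (A \<pi>) = 0"
        proof (rule C_leader[OF i l \<pi>(1)])
          show "2 * r \<le> Suc (sz m \<pi>)" using s i l \<pi>(2)[symmetric] by (simp add: sz_shift)
          fix w assume w: "w \<in> I" "R w < R \<pi>"
          \<comment> \<open>For \<open>w\<close> below \<open>\<pi>\<close>, even the double shift
            ranks below \<open>v\<close>. The induction hypothesis thus evaluates both orders of
            derivation on \<open>A w\<close>, as \<open>C_leader\<close> requires.\<close>
          have sw: "R (shift i (shift l w)) < R v"
            using w i l \<pi> \<pi>I by (metis rk_shift_mono[OF m] shift_idx)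
          have "R (shift l w) < R v" "R (shift i w) < R v"
            using sw rk_shift[OF m i shift_idx[OF l w(1)]] rk_shift[OF m l shift_idx[OF i w(1)]]
            by (simp_all add: shift_commute[of i l])
          then show "C i l (A w) = 0"
            using IH sw w i l by (simp add: C_def shift_idx shift_commute[of l i])
        qed
        moreover have "D l (A \<pi>) = A (shift l \<pi>)" "D i (A \<pi>) = A (shift i \<pi>)"
          using IH[OF l \<pi>I] IH[OF i \<pi>I] \<pi>(2) rk_shift[OF m i shift_idx[OF l \<pi>I]]
            rk_shift[OF m l shift_idx[OF i \<pi>I]] by (simp_all add: shift_commute[of i l])
        ultimately show ?thesis by (simp add: C_def)
      qed
      obtain l w where lw: "l < m" "shift l w = v"
        "(i = l \<and> u = w) \<or> (\<exists>\<pi>. leader \<pi> \<and> u = shift l \<pi> \<and> w = shift i \<pi>)"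
        "(j = l \<and> u' = w) \<or> (\<exists>\<pi>. leader \<pi> \<and> u' = shift l \<pi> \<and> w = shift j \<pi>)"
        using leader_bridge[OF s i 3(1) v(2)[symmetric] j(1-3)] by blast
      have "D i (A u) = D l (A w)" using lw(3) swap[OF i lw(1)] v(2) by auto
      moreover have "D j (A u') = D l (A w)" using lw(4) swap[OF j(1) lw(1)] j(3) by auto
      ultimately show ?thesis using j(4) v(2) by simp
    qed
  qed
qed

text \<open>The commutator is a derivation, so only generators matter: on \<open>K\<close> the given
  derivations commute, and on the values of \<open>A\<close> shifts do.\<close>

lemma D_commute:
  assumes i: "i < m" and l: "l < m" and y: "y \<in> M" shows "D i (D l y) = D l (D i y)"
proof -
  have CA: "C i l (A v) = 0" if "v \<in> I" for v
    using that i l by (simp add: C_def D_A shift_idx shift_commute[of i l])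
  have eL0: "C i l (e x) \<in> {0}" if "x \<in> L" for x
    using that
  proof (rule der_L[rotated -1])
    show "C i l (e y) \<in> {0}" if "y \<in> K \<union> gen ` {v \<in> I. sz m v < 2 * r}" for y
      using that C_K[OF i l] CA by (auto simp flip: A_gen)
  qed (auto intro: C_e[OF i l])
  have "C i l y \<in> {0}"
    using y
  proof (rule der_M[rotated -1])
    show "C i l y \<in> {0}" if "y \<in> e ` L \<union> xv ` N" for y
      using that
    proof
      assume "y \<in> xv ` N"
      then obtain w where "w \<in> N" "y = A w" using A_N by auto
      then show ?thesis using CA[of w] by (simp add: N_def)
    qed (use eL0 in auto)
  qed (auto intro: C[OF i l])
  then show ?thesis by (simp add: C_def)
qed

end

section \<open>Transport to lists\<close>

definition transport_ring :: "('b::field \<Rightarrow> 'c) \<Rightarrow> 'b set \<Rightarrow> 'c ring" where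
  "transport_ring \<iota> M = \<lparr>carrier = \<iota> ` M, monoid.mult = \<lambda>x y. \<iota> (the_inv \<iota> x * the_inv \<iota> y), one = \<iota> 1,
     zero = \<iota> 0, add = \<lambda>x y. \<iota> (the_inv \<iota> x + the_inv \<iota> y)\<rparr>"

lemma transport_ring_field:
  assumes inj: "inj \<iota>" and M: "is_subfield_set M"
  shows "Ring.field (transport_ring \<iota> M)"
proof -
  let ?R = "transport_ring \<iota> M"
  have inv [simp]: "the_inv \<iota> (\<iota> x) = x" for x by (rule the_inv_f_f[OF inj])
  have car: "carrier ?R = \<iota> ` M" by (simp add: transport_ring_def)
  have ops [simp]: "\<iota> x \<oplus>\<^bsub>?R\<^esub> \<iota> y = \<iota> (x + y)" "\<iota> x \<otimes>\<^bsub>?R\<^esub> \<iota> y = \<iota> (x * y)" "\<one>\<^bsub>?R\<^esub> = \<iota> 1" "\<zero>\<^bsub>?R\<^esub> = \<iota> 0" for x y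
    by (simp_all add: transport_ring_def)
  note M' = subfield_setD[OF M]
  have "cring ?R"
  proof (rule cringI)
    show "abelian_group ?R"
    proof (rule abelian_groupI)
      fix x assume "x \<in> carrier ?R"
      then obtain x' where "x = \<iota> x'" "x' \<in> M" by (auto simp: car)
      then show "\<exists>y\<in>carrier ?R. y \<oplus>\<^bsub>?R\<^esub> x = \<zero>\<^bsub>?R\<^esub>"
        using M'(7)[of x'] by (intro bexI[of _ "\<iota> (- x')"]) (auto simp: car)
    qed (auto simp: car M' add_ac)
    show "comm_monoid ?R"
      by (rule comm_monoidI) (auto simp: car M' mult_ac)
  qed (auto simp: car distrib_right)
  moreover have "Units ?R = carrier ?R - {\<zero>\<^bsub>?R\<^esub>}"
  proof
    show "Units ?R \<subseteq> carrier ?R - {\<zero>\<^bsub>?R\<^esub>}"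
      using injD[OF inj] by (fastforce simp: Units_def car)
    show "carrier ?R - {\<zero>\<^bsub>?R\<^esub>} \<subseteq> Units ?R"
    proof
      fix x assume "x \<in> carrier ?R - {\<zero>\<^bsub>?R\<^esub>}"
      then obtain x' where x: "x = \<iota> x'" "x' \<in> M" "x' \<noteq> 0" by (auto simp: car)
      then show "x \<in> Units ?R"
        using M'(6)[of x'] unfolding Units_def by (auto simp: car intro!: bexI[of _ "inverse x'"])
    qed
  qed
  ultimately show ?thesis by (rule cring.cring_fieldI)
qed

theorem theorem4p8:
  fixes K :: "'a::field set" and m n r :: nat
    and d :: "nat \<Rightarrow> 'a \<Rightarrow> 'a"
    and a :: "nat \<Rightarrow> (nat \<Rightarrow> nat) \<Rightarrow> 'a"
  assumes "m > 0" and "n > 0" and "r > 0"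
    and "diff_field K m d"
    and "differential_condition K m d n r a"
    and "\<forall>k<n. (\<forall>\<sigma>. min_sep_leader K m n r a k \<sigma> \<longrightarrow> msize m \<sigma> \<le> r) \<or>
               (\<exists>\<tau>\<in>NN m. msize m \<tau> = 2 * r \<and>
                  (\<forall>\<sigma>. min_sep_leader K m n r a k \<sigma> \<longrightarrow> mle m \<sigma> \<tau>))"
  shows "\<exists>(M :: 'a list ring) (e :: 'a \<Rightarrow> 'a list) (D :: nat \<Rightarrow> 'a list \<Rightarrow> 'a list).
     let L' = gen_field (K \<union> {a h \<xi> | \<xi> h. \<xi> \<in> NN m \<and> msize m \<xi> < 2 * r \<and> h < n}) in
     field M \<and>
     (\<forall>x\<in>L'. e x \<in> carrier M) \<and> inj_on e L' \<and> e 1 = \<one>\<^bsub>M\<^esub> \<and>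
     (\<forall>x\<in>L'. \<forall>y\<in>L'. e (x + y) = e x \<oplus>\<^bsub>M\<^esub> e y \<and> e (x * y) = e x \<otimes>\<^bsub>M\<^esub> e y) \<and>
     (\<forall>i<m. ring_derivation M (D i)) \<and>
     (\<forall>i<m. \<forall>j<m. \<forall>x\<in>carrier M. D i (D j x) = D j (D i x)) \<and>
     (\<forall>i<m. \<forall>x\<in>K. D i (e x) = e (d i x)) \<and>
     (\<forall>i<m. \<forall>k<n. \<forall>\<sigma>\<in>NN m. msize m \<sigma> + 1 < 2 * r \<longrightarrow>
         D i (e (a k \<sigma>)) = e (a k (madd \<sigma> (eps i))))"
proof -
  interpret P: partial_extension K m d n r a
    by unfold_locales (rule assms)+
  obtain \<iota> :: "'a ratfun \<Rightarrow> 'a list" where \<iota>: "inj \<iota>" using ratfun_code by blast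
  have inv [simp]: "the_inv \<iota> (\<iota> x) = x" for x by (rule the_inv_f_f[OF \<iota>])
  define R where "R = transport_ring \<iota> P.M"
  define e' where "e' x = \<iota> (rf_const x)" for x
  define D' where "D' i y = \<iota> (P.Der i P.A (the_inv \<iota> y))" for i y
  have car: "carrier R = \<iota> ` P.M" by (simp add: R_def transport_ring_def)
  have ops: "\<iota> x \<oplus>\<^bsub>R\<^esub> \<iota> y = \<iota> (x + y)" "\<iota> x \<otimes>\<^bsub>R\<^esub> \<iota> y = \<iota> (x * y)" "\<one>\<^bsub>R\<^esub> = \<iota> 1" for x y
    by (simp_all add: R_def transport_ring_def)
  have L: "gen_field (K \<union> {a h \<xi> | \<xi> h. \<xi> \<in> NN m \<and> msize m \<xi> < 2 * r \<and> h < n}) = P.L"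
  proof -
    have "{a h \<xi> | \<xi> h. \<xi> \<in> NN m \<and> msize m \<xi> < 2 * r \<and> h < n} = P.gen ` {v \<in> idx m n. sz m v < 2 * r}"
      by (force simp: P.gen_def idx_def sz_def)
    then show ?thesis by (simp add: P.L_def)
  qed
  have der: "ring_derivation R (D' i)" if i: "i < m" for i
    unfolding ring_derivation_def
  proof (intro conjI ballI)
    fix x assume "x \<in> carrier R"
    then obtain x' where x: "x = \<iota> x'" "x' \<in> P.M" by (auto simp: car)
    show "D' i x \<in> carrier R" using x P.D_M[OF i] by (simp add: D'_def car)
    fix y assume "y \<in> carrier R"
    then obtain y' where y: "y = \<iota> y'" "y' \<in> P.M" by (auto simp: car)
    show "D' i (x \<oplus>\<^bsub>R\<^esub> y) = D' i x \<oplus>\<^bsub>R\<^esub> D' i y"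
      "D' i (x \<otimes>\<^bsub>R\<^esub> y) = (x \<otimes>\<^bsub>R\<^esub> D' i y) \<oplus>\<^bsub>R\<^esub> (D' i x \<otimes>\<^bsub>R\<^esub> y)"
      using P.Der[OF i, of P.A] x y by (simp_all add: D'_def ops der_on_def)
  qed
  have comm: "D' i (D' j x) = D' j (D' i x)" if "i < m" "j < m" "x \<in> carrier R" for i j x
    using that P.D_commute[of i j] by (auto simp: D'_def car)
  have gen: "D' i (e' (a k \<sigma>)) = e' (a k (madd \<sigma> (eps i)))"
    if "i < m" "k < n" "\<sigma> \<in> NN m" "msize m \<sigma> + 1 < 2 * r" for i k \<sigma>
  proof -
    \<comment> \<open>The strict bound keeps the shifted index inside \<open>L\<close>. At order
      \<open>2 * r\<close> the value would be \<open>A0\<close>, possibly a new indeterminate in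
      place of the given generator.\<close>
    have v: "(\<sigma>, k) \<in> idx m n" "sz m (shift i (\<sigma>, k)) < 2 * r"
      using that by (auto simp: idx_def sz_def shift_def msize_madd_eps)
    then show ?thesis
      using P.D_gen[OF that(1) v(1)] P.A_gen[OF v(2)] that
      by (simp add: D'_def e'_def P.gen_def shift_def sz_def)
  qed
  have K: "D' i (e' x) = e' (d i x)" if "i < m" "x \<in> K" for i x
    using that by (simp add: D'_def e'_def P.D_e)
  have "Ring.field R" unfolding R_def by (rule transport_ring_field[OF \<iota> P.M])
  moreover have "inj_on e' P.L"
    using \<iota> P.e.hom_inj by (auto simp: inj_on_def e'_def dest: injD)
  moreover have "\<forall>x\<in>P.L. e' x \<in> carrier R" using P.e_M by (auto simp: e'_def car)
  moreover have "e' 1 = \<one>\<^bsub>R\<^esub>" by (simp add: e'_def ops P.e.hom_one)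
  moreover have "\<forall>x\<in>P.L. \<forall>y\<in>P.L. e' (x + y) = e' x \<oplus>\<^bsub>R\<^esub> e' y \<and> e' (x * y) = e' x \<otimes>\<^bsub>R\<^esub> e' y"
    by (simp add: e'_def ops P.e.hom_add P.e.hom_mult)
  ultimately show ?thesis
    using der comm K gen unfolding L Let_def by (intro exI[of _ R] exI[of _ e'] exI[of _ D']) blast
qed

end
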